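(* Let $g_1:[-1,1]\to[-1,1]$ be the symmetric quadratic map $$g_1(x)=\begin{cases}x+(1+x)^2,&-1\le x\le0,\\ x-(1-x)^2,&0<x\le1.\end{cases}$$ There is a countable uniformly dense set $\mathcal D\subset C([-1,1])$ such that, for every $\phi\in\mathcal D$, there is $C_\phi<\infty$ satisfying $$\sum_{0\le i,j<n}\left|\operatorname{Cov}_m\bigl(\phi\circ g_1^{2^i},\phi\circ g_1^{2^j}\bigr)\right|\le C_\phi\,n\log(n+2)\qquad\text{for every }n\ge1.$$ In particular, for every $\phi\in\mathcal D$ there is $C'_\phi<\infty$ such that this double sum is at most $C'_\phi n^{2-\delta_\phi}$ for all $n\ge1$, with $\delta_\phi=1/2$. Consequently, $$\mu_n^{\mathrm{dyad}}(x)=\frac1n\sum_{k=0}^{n-1}\delta_{g_1^{2^k}x}\longrightarrow\frac12\delta_{-1}+\frac12\delta_1\quad\text{weak-star as }n\to\infty$$ for $m$-almost every $x$, and $m(X_{\mathrm{dyad}})=0$, where $X_{\mathrm{dyad}}$ is the set of $x\in[-1,1]$ for which $\mu_n^{\mathrm{dyad}}(x)$ does not converge weak-star.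
   Context: $m$ is normalized Lebesgue measure on $[-1,1]$; $C([-1,1])$ is the space of real-valued continuous functions with the uniform norm; for bounded measurable $F,H$ on $[-1,1]$, $\operatorname{Cov}_m(F,H)=\int FH\,dm-\left(\int F\,dm\right)\left(\int H\,dm\right)$. *)

theory Defs
  imports "HOL-Probability.Probability"
begin

(* Only the values on [-1,1] matter, by g1_mem below. *)
definition g1 :: "real \<Rightarrow> real" where
  "g1 x = (if x \<le> 0 then x + (1 + x)\<^sup>2 else x - (1 - x)\<^sup>2)"

lemma g1_mem:
  assumes "x \<in> {-1..1}"
  shows "g1 x \<in> {-1..1}"
proof (cases "x \<le> 0")
  case True
  have "x * (x + 3) \<le> 0"
    using True assms by (intro mult_nonpos_nonneg) auto
  then have "x + (1 + x)\<^sup>2 \<le> 1"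
    by (simp add: power2_eq_square algebra_simps)
  moreover have "-1 \<le> x + (1 + x)\<^sup>2"
    using assms zero_le_power2[of "1 + x"] unfolding atLeastAtMost_iff by linarith
  ultimately show ?thesis
    using True by (simp add: g1_def)
next
  case False
  have "0 \<le> x * (3 - x)"
    using False assms by (intro mult_nonneg_nonneg) auto
  then have "-1 \<le> x - (1 - x)\<^sup>2"
    by (simp add: power2_eq_square algebra_simps)
  moreover have "x - (1 - x)\<^sup>2 \<le> 1"
    using assms zero_le_power2[of "1 - x"] unfolding atLeastAtMost_iff by linarith
  ultimately show ?thesis
    using False by (simp add: g1_def)
qed

lemma g1_funpow_mem: "x \<in> {-1..1} \<Longrightarrow> (g1 ^^ k) x \<in> {-1..1}"
  by (induction k) (auto simp del: atLeastAtMost_iff intro: g1_mem)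

definition leb_I :: "real measure" where
  "leb_I = uniform_measure (lebesgue_on {-1..1}) {-1..1}"

definition Cov :: "'a measure \<Rightarrow> ('a \<Rightarrow> real) \<Rightarrow> ('a \<Rightarrow> real) \<Rightarrow> real" where
  "Cov M F H = (\<integral>x. F x * H x \<partial>M) - (\<integral>x. F x \<partial>M) * (\<integral>x. H x \<partial>M)"

(* C([-1,1]) with the supremum metric; its points are the functions that are continuous on
   [-1,1] and extended by undefined outside. *)
definition C_I :: "(real \<Rightarrow> real) metric" where
  "C_I = cfunspace (top_of_set {-1..1}) euclidean_metric"

lemma mem_C_I: "f \<in> mspace C_I \<longleftrightarrow> f \<in> extensional {-1..1} \<and> continuous_on {-1..1} f"
proof -
  have "compactin (top_of_set {-1..1::real}) (topspace (top_of_set {-1..1}))"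
    by (simp add: compactin_subtopology)
  from compactin_mspace_cfunspace[OF this, of "euclidean_metric :: real metric"]
  show ?thesis
    by (auto simp: C_I_def simp del: mspace_cfunspace)
qed

abbreviation borel_I :: "real measure" where
  "borel_I \<equiv> restrict_space borel {-1..1}"

(* The measure \<Sum>i\<in>J. c i * \<delta>(y i) on the Borel sets of [-1,1]. *)
definition dirac_sum :: "'i set \<Rightarrow> ('i \<Rightarrow> real) \<Rightarrow> ('i \<Rightarrow> real) \<Rightarrow> real measure" where
  "dirac_sum J c y =
     measure_of {-1..1} (sets borel_I)
       (\<lambda>A. \<Sum>i\<in>J. ennreal (c i) * emeasure (return borel_I (y i)) A)"

lemma space_dirac_sum [simp]: "space (dirac_sum J c y) = {-1..1}"
  and sets_dirac_sum [measurable_cong, simp]: "sets (dirac_sum J c y) = sets borel_I"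
proof -
  have *: "sets borel_I \<subseteq> Pow {-1..1}"
    using sets.space_closed[of borel_I] by (simp add: space_restrict_space)
  show "space (dirac_sum J c y) = {-1..1}"
    unfolding dirac_sum_def using * by (rule space_measure_of)
  show "sets (dirac_sum J c y) = sets borel_I"
    unfolding dirac_sum_def using sets.sigma_sets_eq[of borel_I]
    by (simp add: sets_measure_of[OF *] space_restrict_space)
qed

lemma emeasure_dirac_sum:
  assumes "A \<in> sets borel_I"
  shows "emeasure (dirac_sum J c y) A = (\<Sum>i\<in>J. ennreal (c i) * indicator A (y i))"
proof -
  let ?\<mu> = "\<lambda>A. \<Sum>i\<in>J. ennreal (c i) * emeasure (return borel_I (y i)) A"
  have "countably_additive (sets borel_I) ?\<mu>"
  proof (rule countably_additiveI)
    fix B :: "nat \<Rightarrow> real set"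
    assume B: "range B \<subseteq> sets borel_I" "disjoint_family B"
    have "(\<Sum>n. ?\<mu> (B n)) = (\<Sum>i\<in>J. \<Sum>n. ennreal (c i) * emeasure (return borel_I (y i)) (B n))"
      by (rule suminf_sum) auto
    also have "\<dots> = ?\<mu> (\<Union>n. B n)"
      using B by (simp add: suminf_emeasure del: emeasure_return)
    finally show "(\<Sum>n. ?\<mu> (B n)) = ?\<mu> (\<Union>n. B n)" .
  qed
  then have "emeasure (dirac_sum J c y) A = ?\<mu> A"
    using assms sets.space_closed[of borel_I]
    by (intro emeasure_measure_of[OF dirac_sum_def])
       (auto simp: positive_def space_restrict_space simp del: emeasure_return)
  with assms show ?thesis
    by simp
qed

definition mu_dyad :: "nat \<Rightarrow> real \<Rightarrow> real measure" where
  "mu_dyad n x = dirac_sum {..<n} (\<lambda>_. 1 / real n) (\<lambda>k. (g1 ^^ (2 ^ k)) x)"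

definition half_half :: "real measure" where
  "half_half = dirac_sum {-1, 1} (\<lambda>_. 1 / 2) (\<lambda>p. p)"

definition weak_star_tendsto :: "(nat \<Rightarrow> real measure) \<Rightarrow> real measure \<Rightarrow> bool" where
  "weak_star_tendsto \<mu> \<nu> \<longleftrightarrow>
     (\<forall>f \<in> mspace C_I. (\<lambda>n. \<integral>x. f x \<partial>\<mu> n) \<longlonglongrightarrow> (\<integral>x. f x \<partial>\<nu>))"

(* Limits are sought among the Borel probability measures on [-1,1]; these form a weak-star closed
   subset of the dual of C([-1,1]) containing mu_dyad n x for n \<ge> 1. *)
definition X_dyad :: "real set" where
  "X_dyad = {x \<in> {-1..1}. \<not> (\<exists>\<nu>. prob_space \<nu> \<and> sets \<nu> = sets borel_I \<and>
                                   weak_star_tendsto (\<lambda>n. mu_dyad n x) \<nu>)}"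

end

theory Submission
  imports Defs "HOL-Library.Discrete_Functions"
begin

text \<open>Let \<open>L\<close> be the transfer operator of \<open>g1\<close> for Lebesgue measure and \<open>P\<close> the inverse of the right branch;
  the inverse of the left branch is \<open>x \<mapsto> - P (- x)\<close>. So with \<open>F = (f \<circ> P) \<cdot> P'\<close> the function \<open>L f\<close> is
  \<open>F x + F (- x)\<close> for even \<open>f\<close> and \<open>F x - F (- x)\<close> for odd \<open>f\<close>. As \<open>P\<close> and \<open>P'\<close> have power series with nonnegative
  coefficients, \<open>L\<close> preserves such series in both parities; in particular the density \<open>f\<^sub>N = L\<^sup>N 1\<close> is one.

  The covariance of \<open>x\<^sup>m \<circ> g1\<^sup>N\<close> and \<open>x\<^sup>l \<circ> g1\<^sup>N\<^sup>+\<^sup>K\<close> is an integral of \<open>x\<^sup>l \<cdot> L\<^sup>K b\<close> with \<open>b = (x\<^sup>m - mean) \<cdot> f\<^sub>N\<close>.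
  If \<open>m\<close> is odd, then \<open>0 \<le> L u \<le> F\<close> on \<open>[0, 1]\<close>, so only mass that starts in \<open>[P\<^sup>K 0, 1]\<close> survives.
  If \<open>m\<close> is even, then \<open>L\<close> acts on the primitive \<open>G x = \<integral>\<^sub>x\<^sup>1 b\<close> by \<open>G \<mapsto> G \<circ> P - G \<circ> P \<circ> uminus\<close>. Dividing by the weight
  \<open>\<sigma> x = x (1 - x) (2 - x) (3 - x)\<close>, for which \<open>\<sigma> (P x) = 1 - x\<^sup>2\<close> is even, gives again an operator that
  preserves power series with nonnegative coefficients. Hence \<open>0 \<le> G\<^sub>K x \<le> G (P\<^sup>K x)\<close>.
  As \<open>1 - P\<^sup>K x \<le> 2 / (K + 2)\<close> and \<open>f\<^sub>N \<le> 1 + N\<close>, the covariance is \<open>O ((1 + N) / (K + 2))\<close>, which decays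
  geometrically in \<open>\<bar>i - j\<bar>\<close> for \<open>N = 2\<^sup>i\<close> and \<open>N + K = 2\<^sup>j\<close>.

  The same positivity for \<open>b = f\<^sub>1 - 1\<close> shows that \<open>f\<^sub>N 0\<close> decreases in \<open>N\<close>. Mass entering at time \<open>k\<close> stays near
  \<open>\<plusminus>1\<close> up to time \<open>N\<close> with probability of order \<open>1 / (N - k)\<close>, so conservation of mass bounds \<open>f\<^sub>N 0\<close> by a
  multiple of the inverse of a harmonic number. So all mass escapes to \<open>\<plusminus>1\<close>, the means converge, and the
  almost sure statement follows by Chebyshev's inequality along the squares.\<close>

section \<open>Power series with nonnegative coefficients\<close>

text \<open>Values of \<open>f\<close> outside the open unit interval are left free, so every
  statement about the endpoint 1 has to be recovered from continuity.\<close>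

definition pos_series :: "(real \<Rightarrow> real) \<Rightarrow> bool" where
  "pos_series f \<longleftrightarrow> (\<exists>a. (\<forall>k. 0 \<le> a k) \<and> (\<forall>x. \<bar>x\<bar> < 1 \<longrightarrow> (\<lambda>k. a k * x ^ k) sums f x))"

lemma pos_seriesI:
  assumes "\<And>k. 0 \<le> a k" "\<And>x. \<bar>x\<bar> < 1 \<Longrightarrow> (\<lambda>k. a k * x ^ k) sums f x"
  shows "pos_series f"
  using assms unfolding pos_series_def by blast

lemma pos_series_cong:
  assumes "pos_series f" "\<And>x. \<bar>x\<bar> < 1 \<Longrightarrow> f x = h x"
  shows "pos_series h"
  using assms unfolding pos_series_def by metis

lemma pos_series_nonneg:
  assumes "pos_series f" "0 \<le> x" "x < 1"
  shows "0 \<le> f x"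
proof -
  obtain a where a: "\<And>k. 0 \<le> a k" "\<And>x. \<bar>x\<bar> < 1 \<Longrightarrow> (\<lambda>k. a k * x ^ k) sums f x"
    using assms by (metis pos_series_def)
  have "(\<lambda>k. a k * x ^ k) sums f x"
    using assms by (intro a(2)) simp
  then show ?thesis
    by (rule sums_le[OF _ sums_zero, rotated]) (simp add: a(1) assms(2))
qed

lemma pos_series_mono:
  assumes "pos_series f" "\<bar>x\<bar> \<le> y" "y < 1"
  shows "\<bar>f x\<bar> \<le> f y"
proof -
  obtain a where a: "\<And>k. 0 \<le> a k" "\<And>x. \<bar>x\<bar> < 1 \<Longrightarrow> (\<lambda>k. a k * x ^ k) sums f x"
    using assms by (metis pos_series_def)
  have le: "\<bar>a k * x ^ k\<bar> \<le> a k * y ^ k" for k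
    using assms(2) a(1)[of k] by (simp add: abs_mult power_abs mult_left_mono power_mono)
  have s: "(\<lambda>k. a k * y ^ k) sums f y" "(\<lambda>k. a k * x ^ k) sums f x"
    using assms by (auto intro!: a(2))
  have "a k * x ^ k \<le> a k * y ^ k" "- (a k * y ^ k) \<le> a k * x ^ k" for k
    using le[of k] by linarith+
  then have "f x \<le> f y" "- f y \<le> f x"
    using sums_le[OF _ s(2) s(1)] sums_le[OF _ sums_minus[OF s(1)] s(2)] by auto
  then show ?thesis
    by linarith
qed

lemma pos_series_const: "0 \<le> c \<Longrightarrow> pos_series (\<lambda>_. c)"
proof (rule pos_seriesI[where a = "\<lambda>k. if k = 0 then c else 0"])
  fix x :: real
  show "(\<lambda>k. (if k = 0 then c else 0) * x ^ k) sums c"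
    using sums_single[of 0 "\<lambda>k. c * x ^ k"] by (simp add: if_distrib[of "\<lambda>t. t * _"] cong: if_cong)
qed auto

lemma pos_series_ident: "pos_series (\<lambda>x. x)"
proof (rule pos_seriesI[where a = "\<lambda>k. if k = 1 then 1 else 0"])
  fix x :: real
  show "(\<lambda>k. (if k = 1 then 1 else 0) * x ^ k) sums x"
    using sums_single[of 1 "\<lambda>k. x ^ k"] by (simp add: if_distrib[of "\<lambda>t. t * _"] cong: if_cong)
qed auto

lemma pos_series_add:
  assumes "pos_series f" "pos_series h"
  shows "pos_series (\<lambda>x. f x + h x)"
proof -
  obtain a b where "\<And>k. 0 \<le> a k" "\<And>x. \<bar>x\<bar> < 1 \<Longrightarrow> (\<lambda>k. a k * x ^ k) sums f x"
    and "\<And>k. 0 \<le> b k" "\<And>x. \<bar>x\<bar> < 1 \<Longrightarrow> (\<lambda>k. b k * x ^ k) sums h x"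
    using assms by (metis pos_series_def)
  then show ?thesis
    by (intro pos_seriesI[where a = "\<lambda>k. a k + b k"]) (auto simp: distrib_right intro: sums_add)
qed

lemma power_series_abs_summable:
  fixes a :: "nat \<Rightarrow> real"
  assumes "\<And>x. \<bar>x\<bar> < 1 \<Longrightarrow> summable (\<lambda>k. a k * x ^ k)" "\<bar>x\<bar> < 1"
  shows "summable (\<lambda>k. \<bar>a k * x ^ k\<bar>)"
proof -
  obtain y where "\<bar>x\<bar> < y" "y < 1"
    using assms(2) dense by blast
  then show ?thesis
    using powser_insidea[OF assms(1), of y x] by (simp add: abs_mult power_abs)
qed

lemma power_series_mult:
  fixes a b :: "nat \<Rightarrow> real"
  assumes "\<And>x. \<bar>x\<bar> < 1 \<Longrightarrow> (\<lambda>k. a k * x ^ k) sums f x"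
    and "\<And>x. \<bar>x\<bar> < 1 \<Longrightarrow> (\<lambda>k. b k * x ^ k) sums h x" and "\<bar>x\<bar> < 1"
  shows "(\<lambda>k. (\<Sum>i\<le>k. a i * b (k - i)) * x ^ k) sums (f x * h x)"
proof -
  have "(\<lambda>k. \<Sum>i\<le>k. (a i * x ^ i) * (b (k - i) * x ^ (k - i))) sums
      ((\<Sum>k. a k * x ^ k) * (\<Sum>k. b k * x ^ k))"
    using assms by (intro Cauchy_product_sums)
      (auto intro!: power_series_abs_summable[simplified] dest: sums_summable)
  moreover have "(\<Sum>k. a k * x ^ k) = f x" "(\<Sum>k. b k * x ^ k) = h x"
    using assms by (auto intro: sums_unique[symmetric])
  moreover have "(\<Sum>i\<le>k. (a i * x ^ i) * (b (k - i) * x ^ (k - i))) = (\<Sum>i\<le>k. a i * b (k - i)) * x ^ k" for k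
    unfolding sum_distrib_right
    by (rule sum.cong) (auto simp: mult_ac simp flip: power_add)
  ultimately show ?thesis
    by simp
qed

lemma pos_series_mult:
  assumes "pos_series f" "pos_series h"
  shows "pos_series (\<lambda>x. f x * h x)"
proof -
  obtain a b where ab: "\<And>k. 0 \<le> a k" "\<And>x. \<bar>x\<bar> < 1 \<Longrightarrow> (\<lambda>k. a k * x ^ k) sums f x"
    "\<And>k. 0 \<le> b k" "\<And>x. \<bar>x\<bar> < 1 \<Longrightarrow> (\<lambda>k. b k * x ^ k) sums h x"
    using assms by (metis pos_series_def)
  show ?thesis
  proof (rule pos_seriesI)
    show "0 \<le> (\<Sum>i\<le>k. a i * b (k - i))" for k
      using ab by (intro sum_nonneg mult_nonneg_nonneg)
  qed (rule power_series_mult[OF ab(2) ab(4)])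
qed

lemma pos_series_power: "pos_series f \<Longrightarrow> pos_series (\<lambda>x. f x ^ n)"
  by (induction n) (auto intro: pos_series_const pos_series_mult)

text \<open>Expanding each power of \<open>h\<close> turns \<open>f (h x)\<close> into a double
  series with terms \<open>a n * b n k * x ^ k\<close>. It converges absolutely, so it may be summed
  by columns, and these yield nonnegative coefficients. The hypothesis \<open>lt\<close> keeps
  \<open>h \<bar>x\<bar>\<close> inside the disc of \<open>f\<close>.\<close>

lemma pos_series_compose:
  assumes f: "pos_series f" and h: "pos_series h" and lt: "\<And>x. 0 \<le> x \<Longrightarrow> x < 1 \<Longrightarrow> h x < 1"
  shows "pos_series (\<lambda>x. f (h x))"
proof -
  obtain a where a: "\<And>k. 0 \<le> a k" "\<And>x. \<bar>x\<bar> < 1 \<Longrightarrow> (\<lambda>k. a k * x ^ k) sums f x"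
    using f by (metis pos_series_def)
  have "\<forall>n. \<exists>b. (\<forall>k. 0 \<le> b k) \<and> (\<forall>x. \<bar>x\<bar> < 1 \<longrightarrow> (\<lambda>k. b k * x ^ k) sums (h x ^ n))"
    using pos_series_power[OF h] by (simp add: pos_series_def)
  then obtain b where b: "\<And>n k. 0 \<le> b n k" "\<And>n x. \<bar>x\<bar> < 1 \<Longrightarrow> (\<lambda>k. b n k * x ^ k) sums (h x ^ n)"
    by metis
  have hb: "\<bar>h x\<bar> \<le> h \<bar>x\<bar>" "h \<bar>x\<bar> < 1" if "\<bar>x\<bar> < 1" for x
    using that pos_series_mono[OF h] lt by auto
  have S: "((\<lambda>(n, k). a n * b n k * x ^ k) has_sum f (h x)) UNIV"
    and T: "\<And>k. (\<lambda>n. a n * b n k * x ^ k) summable_on UNIV"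
    if x: "\<bar>x\<bar> < 1" for x
  proof -
    \<comment> \<open>At \<open>\<bar>x\<bar>\<close> all terms are nonnegative, so the row sums
      alone prove summability over pairs; this dominates the family at \<open>x\<close>.\<close>
    have inner: "((\<lambda>k. a n * b n k * \<bar>x\<bar> ^ k) has_sum (a n * h \<bar>x\<bar> ^ n)) UNIV" for n
      using sums_mult[OF b(2)[of "\<bar>x\<bar>" n], of "a n"] x a(1) b(1)
      by (intro sums_nonneg_imp_has_sum) (auto simp: mult.assoc)
    have outer: "((\<lambda>n. a n * h \<bar>x\<bar> ^ n) has_sum f (h \<bar>x\<bar>)) UNIV"
      using x a hb[OF x] pos_series_nonneg[OF h]
      by (intro sums_nonneg_imp_has_sum) auto
    have "(\<lambda>(n, k). a n * b n k * \<bar>x\<bar> ^ k) summable_on (UNIV \<times> UNIV)"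
      using inner outer a(1) b(1)
      by (intro summable_on_SigmaI[where g = "\<lambda>n. a n * h \<bar>x\<bar> ^ n"]) (auto dest: has_sum_imp_summable)
    then have abs: "(\<lambda>p. norm (case p of (n, k) \<Rightarrow> a n * b n k * x ^ k)) summable_on (UNIV \<times> UNIV)"
      using a(1) b(1) by (simp add: abs_mult power_abs case_prod_unfold)
    then have sm: "(\<lambda>(n, k). a n * b n k * x ^ k) summable_on (UNIV \<times> UNIV)"
      using abs_summable_summable by blast
    have in': "((\<lambda>k. a n * b n k * x ^ k) has_sum (a n * h x ^ n)) UNIV" for n
    proof -
      have "(\<lambda>k. norm (a n * b n k * x ^ k)) summable_on UNIV"
        using has_sum_imp_summable[OF inner[of n]] a(1) b(1) by (simp add: abs_mult power_abs)
      then have "(\<lambda>k. a n * b n k * x ^ k) summable_on UNIV"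
        by (rule abs_summable_summable)
      then have "((\<lambda>k. a n * b n k * x ^ k) has_sum (\<Sum>\<^sub>\<infinity>k. a n * b n k * x ^ k)) UNIV"
        by (rule has_sum_infsum)
      moreover from has_sum_imp_sums[OF this] have "(\<Sum>\<^sub>\<infinity>k. a n * b n k * x ^ k) = a n * h x ^ n"
        using sums_mult[OF b(2)[OF x, of n], of "a n"] by (auto simp: mult.assoc dest: sums_unique2)
      ultimately show ?thesis
        by simp
    qed
    have "((\<lambda>n. a n * h x ^ n) has_sum infsum (\<lambda>(n, k). a n * b n k * x ^ k) (UNIV \<times> UNIV)) UNIV"
      using in' by (intro has_sum_SigmaD[OF has_sum_infsum[OF sm]]) auto
    moreover from has_sum_imp_sums[OF this] have "infsum (\<lambda>(n, k). a n * b n k * x ^ k) (UNIV \<times> UNIV) = f (h x)"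
      using a(2)[of "h x"] hb[OF x] by (auto dest: sums_unique2)
    ultimately show "((\<lambda>(n, k). a n * b n k * x ^ k) has_sum f (h x)) UNIV"
      using has_sum_infsum[OF sm] by simp
    show "(\<lambda>n. a n * b n k * x ^ k) summable_on UNIV" for k
    proof -
      have "(\<lambda>(k, n). a n * b n k * x ^ k) summable_on (UNIV \<times> UNIV)"
        using sm by (subst summable_on_swap) (simp add: case_prod_unfold)
      then show ?thesis
        by (rule summable_on_SigmaD1[where A = UNIV and B = "\<lambda>_. UNIV"]) simp
    qed
  qed
  define c where "c k = (\<Sum>\<^sub>\<infinity>n. a n * b n k)" for k
  show ?thesis
  proof (rule pos_seriesI[where a = c])
    show "0 \<le> c k" for k
      unfolding c_def using a(1) b(1) by (intro infsum_nonneg) simp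
    fix x :: real assume x: "\<bar>x\<bar> < 1"
    have col: "((\<lambda>n. a n * b n k * x ^ k) has_sum (c k * x ^ k)) UNIV" for k
    proof -
      \<comment> \<open>Any nonzero point of the disc would do in place of \<open>1/2\<close>: its
        power cancels and leaves summability of the coefficients.\<close>
      have "(\<lambda>n. a n * b n k * (1/2) ^ k) summable_on UNIV"
        by (rule T) simp
      then have "(\<lambda>n. a n * b n k) summable_on UNIV"
        by (simp add: summable_on_cmult_left')
      then show ?thesis
        unfolding c_def by (intro has_sum_cmult_left has_sum_infsum)
    qed
    have "((\<lambda>(k, n). a n * b n k * x ^ k) has_sum f (h x)) (UNIV \<times> UNIV)"
      using S[OF x] by (subst has_sum_swap) (simp add: case_prod_unfold)
    then have "((\<lambda>k. c k * x ^ k) has_sum f (h x)) UNIV"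
      by (rule has_sum_SigmaD) (use col in auto)
    then show "(\<lambda>k. c k * x ^ k) sums f (h x)"
      by (rule has_sum_imp_sums)
  qed
qed

section \<open>Parity parts and term-by-term integration\<close>

lemma pos_series_even_part:
  assumes "pos_series f"
  shows "pos_series (\<lambda>x. f x + f (- x))"
proof -
  obtain a where a: "\<And>k. 0 \<le> a k" "\<And>x. \<bar>x\<bar> < 1 \<Longrightarrow> (\<lambda>k. a k * x ^ k) sums f x"
    using assms by (metis pos_series_def)
  show ?thesis
  proof (rule pos_seriesI[where a = "\<lambda>k. a k * (1 + (-1) ^ k)"])
    show "0 \<le> a k * (1 + (-1) ^ k)" for k
      using a(1)[of k] by (cases "even k") auto
    fix x :: real assume "\<bar>x\<bar> < 1"
    then have "(\<lambda>k. a k * x ^ k + a k * (- x) ^ k) sums (f x + f (- x))"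
      by (intro sums_add a) auto
    then show "(\<lambda>k. a k * (1 + (-1) ^ k) * x ^ k) sums (f x + f (- x))"
      by (simp add: algebra_simps power_minus[of x])
  qed
qed

text \<open>Only odd powers survive, each with twice its coefficient. The factor \<open>x\<close> is
  split off because it later supplies the zero of \<open>weight\<close> at 0.\<close>

lemma pos_series_odd_part:
  assumes "pos_series f"
  obtains h where "pos_series h" "\<And>x. \<bar>x\<bar> < 1 \<Longrightarrow> f x - f (- x) = x * h x"
proof -
  obtain a where a: "\<And>k. 0 \<le> a k" "\<And>x. \<bar>x\<bar> < 1 \<Longrightarrow> (\<lambda>k. a k * x ^ k) sums f x"
    using assms by (metis pos_series_def)
  define b where "b k = a (Suc k) * (1 + (-1) ^ k)" for k
  have s: "(\<lambda>k. x * (b k * x ^ k)) sums (f x - f (- x))" if "\<bar>x\<bar> < 1" for x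
  proof -
    have "(\<lambda>k. a k * x ^ k - a k * (- x) ^ k) sums (f x - f (- x))"
      using that by (intro sums_diff a) auto
    then have "(\<lambda>k. a (Suc k) * x ^ Suc k - a (Suc k) * (- x) ^ Suc k) sums (f x - f (- x))"
      by (subst sums_Suc_iff) simp
    then show ?thesis
      by (simp add: b_def algebra_simps power_minus[of x])
  qed
  have sb: "summable (\<lambda>k. b k * x ^ k)" if "\<bar>x\<bar> < 1" for x
    using sums_summable[OF s[OF that]] by (cases "x = 0") (auto simp: summable_cmult_iff)
  show thesis
  proof (rule that[of "\<lambda>x. \<Sum>k. b k * x ^ k"])
    show "pos_series (\<lambda>x. \<Sum>k. b k * x ^ k)"
    proof (rule pos_seriesI[where a = b])
      show "0 \<le> b k" for k
        using a(1)[of "Suc k"] by (cases "even k") (auto simp: b_def)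
    qed (use sb in \<open>auto intro: summable_sums\<close>)
    show "f x - f (- x) = x * (\<Sum>k. b k * x ^ k)" if "\<bar>x\<bar> < 1" for x
      using s[OF that] sums_mult[OF summable_sums[OF sb[OF that]], of x] by (rule sums_unique2)
  qed
qed

text \<open>The integrated series converges by comparison with the original one and has derivative
  \<open>f\<close>, so it differs from \<open>F\<close> by a constant. Choosing \<open>F 0\<close>
  as its constant coefficient makes that constant 0.\<close>

lemma power_series_antiderivative:
  fixes a :: "nat \<Rightarrow> real"
  assumes a: "\<And>x. \<bar>x\<bar> < 1 \<Longrightarrow> (\<lambda>k. a k * x ^ k) sums f x"
    and F: "\<And>x. \<bar>x\<bar> < 1 \<Longrightarrow> (F has_real_derivative f x) (at x)" and x: "\<bar>x\<bar> < 1"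
  shows "(\<lambda>k. a k / real (Suc k) * x ^ Suc k) sums (F x - F 0)"
proof -
  define c where "c k = (if k = 0 then F 0 else a (k - 1) / real k)" for k
  have dc: "diffs c = a"
    by (auto simp: diffs_def c_def fun_eq_iff)
  have sc: "summable (\<lambda>k. c k * x ^ k)" if "\<bar>x\<bar> < 1" for x
  proof (rule summable_comparison_test_ev)
    have "summable (\<lambda>k. \<bar>a k * x ^ k\<bar>)"
      using power_series_abs_summable[of a x] a that by (auto dest: sums_summable)
    then show "summable (\<lambda>k. if k = 0 then \<bar>F 0\<bar> else \<bar>a (k - 1) * x ^ (k - 1)\<bar>)"
      by (subst summable_Suc_iff[symmetric]) simp
    show "\<forall>\<^sub>F k in sequentially. norm (c k * x ^ k) \<le> (if k = 0 then \<bar>F 0\<bar> else \<bar>a (k - 1) * x ^ (k - 1)\<bar>)"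
    proof (rule always_eventually, rule allI)
      fix k
      show "norm (c k * x ^ k) \<le> (if k = 0 then \<bar>F 0\<bar> else \<bar>a (k - 1) * x ^ (k - 1)\<bar>)"
      proof (cases k)
        case (Suc j)
        have "\<bar>x\<bar> / real (Suc j) \<le> 1"
          using that by (simp add: divide_le_eq)
        then have "\<bar>a j * x ^ j\<bar> * (\<bar>x\<bar> / real (Suc j)) \<le> \<bar>a j * x ^ j\<bar>"
          by (rule mult_left_le) simp
        then show ?thesis
          by (simp add: Suc c_def abs_mult mult_ac)
      qed (simp add: c_def)
    qed
  qed
  define S where "S x = (\<Sum>k. c k * x ^ k)" for x
  have dS: "(S has_real_derivative f x) (at x)" if "\<bar>x\<bar> < 1" for x
    using termdiffs_strong'[of 1 c x] sc that sums_unique[OF a[OF that]] unfolding S_def dc by simp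
  have "((\<lambda>x. F x - S x) has_real_derivative 0) (at x within {-1<..<1})" if "x \<in> {-1<..<1}" for x
    using DERIV_diff[OF F[of x] dS[of x]] that
    by (auto intro: has_field_derivative_at_within)
  then obtain C where C: "\<And>x. x \<in> {-1<..<1} \<Longrightarrow> F x - S x = C"
    using has_field_derivative_zero_constant[of "{-1<..<1::real}"] by (metis convex_real_interval(8))
  have "S 0 = F 0"
    by (simp add: S_def c_def powser_zero)
  then have "S x = F x"
    using C[of 0] C[of x] x by (auto simp: abs_less_iff)
  then have "(\<lambda>k. c k * x ^ k) sums F x"
    using summable_sums[OF sc[OF x]] by (simp add: S_def)
  then have "(\<lambda>k. c (Suc k) * x ^ Suc k) sums (F x - c 0 * x ^ 0)"
    by (subst sums_Suc_iff) simp
  then show ?thesis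
    by (simp add: c_def)
qed

lemma pos_series_antiderivative:
  assumes "pos_series f" "\<And>x. \<bar>x\<bar> < 1 \<Longrightarrow> (F has_real_derivative f x) (at x)" "0 \<le> F 0"
  shows "pos_series F"
proof -
  obtain a where a: "\<And>k. 0 \<le> a k" "\<And>x. \<bar>x\<bar> < 1 \<Longrightarrow> (\<lambda>k. a k * x ^ k) sums f x"
    using assms by (metis pos_series_def)
  show ?thesis
  proof (rule pos_seriesI[where a = "\<lambda>k. if k = 0 then F 0 else a (k - 1) / real k"])
    fix x :: real assume "\<bar>x\<bar> < 1"
    with power_series_antiderivative[of a f F x] a(2) assms(2)
    have "(\<lambda>k. a k / real (Suc k) * x ^ Suc k) sums (F x - F 0)"
      by blast
    then show "(\<lambda>k. (if k = 0 then F 0 else a (k - 1) / real k) * x ^ k) sums F x"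
      using sums_Suc_iff[of "\<lambda>k. (if k = 0 then F 0 else a (k - 1) / real k) * x ^ k" "F x - F 0"] by simp
  qed (use a(1) assms(3) in auto)
qed

section \<open>The transfer operator\<close>

definition rinv :: "real \<Rightarrow> real" where
  "rinv x = (3 - sqrt (5 - 4 * x)) / 2"

definition drinv :: "real \<Rightarrow> real" where
  "drinv x = 1 / sqrt (5 - 4 * x)"

text \<open>The right branch of \<open>g1\<close> is \<open>y\<close> mapped to
  \<open>3 * y - y\<^sup>2 - 1\<close>; \<open>rinv\<close>, called \<open>P\<close> above, picks
  the smaller root of the resulting quadratic equation.\<close>

lemma rinv_quadratic: "x \<le> 5/4 \<Longrightarrow> 3 * rinv x - (rinv x)\<^sup>2 - 1 = x"
  by (simp add: rinv_def power_divide power2_diff field_simps)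

lemma sqrt_bounds:
  assumes "x \<in> {-1..1}"
  shows "1 \<le> sqrt (5 - 4 * x)" "sqrt (5 - 4 * x) \<le> 3"
  using assms by (auto intro: real_le_lsqrt)

lemma rinv_bounds: "x \<in> {-1..1} \<Longrightarrow> 0 \<le> rinv x" "x \<in> {-1..1} \<Longrightarrow> rinv x \<le> 1"
  using sqrt_bounds[of x] by (auto simp: rinv_def)

lemma rinv_mono: "x \<le> y \<Longrightarrow> rinv x \<le> rinv y"
  by (simp add: rinv_def)

lemma rinv_strict_mono: "x < y \<Longrightarrow> rinv x < rinv y"
  by (simp add: rinv_def)

lemma rinv_1 [simp]: "rinv 1 = 1"
  by (simp add: rinv_def)

lemma rinv_m1 [simp]: "rinv (- 1) = 0"
proof -
  have "sqrt 9 = (3::real)"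
    by (rule real_sqrt_unique) auto
  then show ?thesis
    by (simp add: rinv_def)
qed

lemma rinv_less_1: "x < 1 \<Longrightarrow> rinv x < 1"
  using rinv_strict_mono[of x 1] by simp

lemma rinv_pos: "- 1 < x \<Longrightarrow> 0 < rinv x"
  using rinv_strict_mono[of "- 1" x] by simp

text \<open>The point -1 is left out because \<open>rinv (- 1) = 0\<close>, and \<open>g1\<close>
  assigns 0 to its left branch, with value 1.\<close>

lemma g1_rinv: "- 1 < x \<Longrightarrow> x \<le> 1 \<Longrightarrow> g1 (rinv x) = x"
  using rinv_quadratic[of x] rinv_pos[of x] by (simp add: g1_def power2_diff algebra_simps power2_eq_square)

lemma g1_minus_rinv:
  assumes "x \<in> {-1..1}"
  shows "g1 (- rinv (- x)) = x"
  using rinv_quadratic[of "- x"] rinv_bounds[of "- x"] assms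
  by (simp add: g1_def power2_sum algebra_simps power2_eq_square)

lemma drinv_bounds: "x \<in> {-1..1} \<Longrightarrow> 1 / 3 \<le> drinv x" "x \<in> {-1..1} \<Longrightarrow> drinv x \<le> 1"
  using sqrt_bounds[of x] by (auto simp: drinv_def field_simps)

lemma drinv_pos: "x \<in> {-1..1} \<Longrightarrow> 0 < drinv x"
  using drinv_bounds(1)[of x] by linarith

lemma DERIV_rinv: "x \<in> {-1..1} \<Longrightarrow> (rinv has_real_derivative drinv x) (at x within S)"
  unfolding rinv_def drinv_def
  by (auto intro!: derivative_eq_intros simp: field_simps)

lemma DERIV_minus_rinv_minus:
  "x \<in> {-1..1} \<Longrightarrow> ((\<lambda>x. - rinv (- x)) has_real_derivative drinv (- x)) (at x within S)"
  unfolding rinv_def drinv_def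
  by (auto intro!: derivative_eq_intros simp: field_simps)

lemma continuous_on_rinv: "continuous_on S rinv"
  unfolding rinv_def by (intro continuous_intros) auto

lemma continuous_on_drinv: "continuous_on {-1..1} drinv"
  unfolding drinv_def by (intro continuous_intros) auto

text \<open>Binomial series of \<open>(5 - 4 * x) powr (- (1/2))\<close>: the sign of the
  generalized binomial coefficient cancels the sign of \<open>(- (4/5)) ^ k\<close>.\<close>

lemma pos_series_drinv: "pos_series drinv"
proof (rule pos_seriesI[where a = "\<lambda>k. 5 powr (- (1/2)) * (((- (1/2)) gchoose k) * (- (4/5)) ^ k)"])
  fix k :: nat
  have "((- (1/2)) gchoose k) * (- (4/5)) ^ k = pochhammer (1/2) k / fact k * (4/5 :: real) ^ k"
    unfolding gbinomial_pochhammer power_minus[of "4/5"]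
    by (simp add: left_minus_one_mult_self field_simps flip: power_add)
  then show "0 \<le> 5 powr (- (1/2)) * (((- (1/2)) gchoose k) * (- (4/5)) ^ k :: real)"
    by (simp add: pochhammer_nonneg)
next
  fix x :: real assume x: "\<bar>x\<bar> < 1"
  have "(\<lambda>n. ((- (1/2)) gchoose n) * (- (4/5) * x) ^ n) sums (1 + - (4/5) * x) powr (- (1/2))"
    using x by (intro gen_binomial_real) (simp add: abs_mult)
  then have "(\<lambda>n. 5 powr (- (1/2)) * (((- (1/2)) gchoose n) * (- (4/5) * x) ^ n)) sums
      (5 powr (- (1/2)) * (1 + - (4/5) * x) powr (- (1/2)))"
    by (rule sums_mult)
  moreover have "5 powr (- (1/2)) * (1 + - (4/5) * x) powr (- (1/2)) = (5 - 4 * x) powr (- (1/2))"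
    using x by (subst powr_mult[symmetric]) (auto simp: algebra_simps)
  moreover have "(5 - 4 * x) powr (- (1/2)) = drinv x"
    using x by (simp add: drinv_def powr_minus powr_half_sqrt field_simps)
  ultimately show "(\<lambda>k. 5 powr (- (1/2)) * (((- (1/2)) gchoose k) * (- (4/5)) ^ k) * x ^ k) sums drinv x"
    unfolding power_mult_distrib by (simp add: mult.assoc)
qed

lemma pos_series_rinv: "pos_series rinv"
  by (rule pos_series_antiderivative[OF pos_series_drinv]) (auto intro!: DERIV_rinv rinv_bounds(1) simp: abs_less_iff)

lemma pos_series_inverse_diff:
  assumes "1 \<le> c"
  shows "pos_series (\<lambda>x. 1 / (c - x))"
proof (rule pos_seriesI[where a = "\<lambda>k. (1 / c) ^ Suc k"])
  fix x :: real assume x: "\<bar>x\<bar> < 1"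
  have "(\<lambda>k. 1 / c * (x / c) ^ k) sums (1 / c * (1 / (1 - x / c)))"
    using x assms by (intro sums_mult geometric_sums) auto
  moreover have "1 / c * (1 / (1 - x / c)) = 1 / (c - x)"
    using x assms by (simp add: field_simps)
  ultimately show "(\<lambda>k. (1 / c) ^ Suc k * x ^ k) sums (1 / (c - x))"
    by (simp add: power_divide mult_ac)
qed (use assms in auto)

lemma pos_series_rinv_compose: "pos_series f \<Longrightarrow> pos_series (\<lambda>x. f (rinv x))"
  by (rule pos_series_compose[OF _ pos_series_rinv rinv_less_1])

section \<open>Speed of approach to the neutral fixed point 1\<close>

lemma rinv_factorization:
  assumes "0 \<le> x" "x \<le> 1"
  shows "1 - x = (1 - rinv x) * (2 - rinv x)" "1 + x = rinv x * (3 - rinv x)"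
  using rinv_quadratic[of x] assms by (auto simp: algebra_simps power2_eq_square)

lemma rinv_funpow_bounds: "x \<in> {0..1} \<Longrightarrow> (rinv ^^ k) x \<in> {0..1}"
  using rinv_bounds by (induction k) (auto simp: rinv_bounds)

text \<open>If \<open>u\<close> is the distance of \<open>rinv y\<close> from 1, then
  \<open>1 - y = u * (1 + u)\<close>. This is the quadratic recursion of a neutral fixed point,
  which forces decay of order \<open>1 / k\<close>; the constants are chosen so that the induction
  closes.\<close>

lemma one_minus_rinv_funpow_le:
  assumes "x \<in> {0..1}"
  shows "1 - (rinv ^^ k) x \<le> 2 / (real k + 2)"
proof (induction k)
  case (Suc k)
  define y where "y = (rinv ^^ k) x"
  define u where "u = 1 - rinv y"
  have y: "y \<in> {0..1}"
    using rinv_funpow_bounds[OF assms] by (simp add: y_def)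
  have u: "0 \<le> u" "1 - y = u * (1 + u)" "u \<le> 1"
    using rinv_factorization(1)[of y] rinv_bounds[of y] y by (auto simp: u_def)
  have *: "u * (1 + u) * (real k + 2) \<le> 2"
    using Suc u by (simp add: y_def[symmetric] field_simps)
  have "u * (real k + 3) \<le> 2"
  proof (rule ccontr)
    assume "\<not> u * (real k + 3) \<le> 2"
    then have a: "2 < u * (real k + 3)"
      by simp
    then have "0 < u"
      using u(1) by (cases "u = 0") auto
    then have "u * 2 < u * (u * (real k + 3))"
      using a by simp
    moreover have "u * (1 + u) * (real k + 2) = u * (real k + 3) + (u * (u * (real k + 3)) - u) - u * u"
      by (simp add: algebra_simps)
    moreover have "u * u \<le> u"
      using u by (simp add: mult_left_le)
    ultimately show False
      using * a by linarith
  qed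
  then show ?case
    by (simp add: u_def y_def field_simps)
qed (use assms in auto)

text \<open>The same recursion, started at distance 1 from the fixed point, also shows that the
  decay is no faster than order \<open>1 / k\<close>.\<close>

lemma one_minus_rinv_funpow_ge: "1 / (real k + 1) \<le> 1 - (rinv ^^ k) 0"
proof (induction k)
  case (Suc k)
  define y where "y = (rinv ^^ k) 0"
  define u where "u = 1 - rinv y"
  have y: "y \<in> {0..1}"
    using rinv_funpow_bounds[of 0] by (simp add: y_def)
  have u: "0 \<le> u" "1 - y = u * (1 + u)" "u \<le> 1"
    using rinv_factorization(1)[of y] rinv_bounds[of y] y by (auto simp: u_def)
  have *: "1 \<le> u * (1 + u) * (real k + 1)"
    using Suc u by (simp add: y_def[symmetric] field_simps)
  have "1 \<le> u * (real k + 2)"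
  proof (rule ccontr)
    assume "\<not> 1 \<le> u * (real k + 2)"
    then have a: "u * (real k + 2) < 1"
      by simp
    have "u * (u * (real k + 2)) \<le> u * 1"
      using a u(1) by (intro mult_left_mono) auto
    moreover have "u * (1 + u) * (real k + 1) = u * (real k + 2) + (u * (u * (real k + 2)) - u) - u * u"
      by (simp add: algebra_simps)
    ultimately show False
      using * a zero_le_square[of u] by linarith
  qed
  then show ?case
    by (simp add: u_def y_def field_simps)
qed auto

section \<open>The operator and its duality with composition by \<open>g1\<close>\<close>

definition transfer :: "(real \<Rightarrow> real) \<Rightarrow> real \<Rightarrow> real" where
  "transfer f x = f (rinv x) * drinv x + f (- rinv (- x)) * drinv (- x)"

lemma transfer_diff: "transfer (\<lambda>x. f x - h x) = (\<lambda>x. transfer f x - transfer h x)"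
  by (simp add: transfer_def fun_eq_iff algebra_simps)

lemma transfer_mult: "transfer (\<lambda>x. c * f x) = (\<lambda>x. c * transfer f x)"
  by (simp add: transfer_def fun_eq_iff algebra_simps)

lemma continuous_on_transfer:
  assumes "continuous_on {-1..1} f"
  shows "continuous_on {-1..1} (transfer f)"
proof -
  have "continuous_on {-1..1} (\<lambda>x. rinv (- x))" "continuous_on {-1..1} (\<lambda>x. drinv (- x))"
    by (auto intro!: continuous_on_compose2[OF continuous_on_rinv[of UNIV]]
        continuous_on_compose2[OF continuous_on_drinv] continuous_intros)
  then show ?thesis
    unfolding transfer_def using rinv_bounds rinv_bounds[of "- x" for x]
    by (intro continuous_intros continuous_on_compose2[OF assms] continuous_on_rinv continuous_on_drinv)
       (auto, (smt (verit) atLeastAtMost_iff)+)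
qed

lemma continuous_on_transfer_funpow:
  "continuous_on {-1..1} f \<Longrightarrow> continuous_on {-1..1} ((transfer ^^ k) f)"
  by (induction k) (auto intro: continuous_on_transfer)

lemma g1_borel [measurable]: "g1 \<in> borel_measurable borel"
  unfolding g1_def by measurable

lemma g1_funpow_borel [measurable]: "(g1 ^^ k) \<in> borel_measurable borel"
  by (induction k) (auto simp: o_def)

lemma set_integrable_bounded_mult:
  assumes [measurable]: "\<psi> \<in> borel_measurable borel" and B: "\<And>x. x \<in> {a..b} \<Longrightarrow> \<bar>\<psi> x\<bar> \<le> B"
    and f: "continuous_on {a..b} f"
  shows "set_integrable lborel {a..b::real} (\<lambda>x. \<psi> x * f x :: real)"
proof -
  have i: "set_integrable lborel {a..b} f"
    using f by (rule borel_integrable_atLeastAtMost')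
  then have [measurable]: "(\<lambda>x. indicator {a..b} x *\<^sub>R f x) \<in> borel_measurable borel"
    unfolding set_integrable_def by auto
  have "integrable lborel (\<lambda>x. \<psi> x * (indicator {a..b} x *\<^sub>R f x))"
  proof (rule Bochner_Integration.integrable_bound)
    show "integrable lborel (\<lambda>x. B * (indicator {a..b} x *\<^sub>R f x))"
      using i unfolding set_integrable_def by auto
    show "AE x in lborel. norm (\<psi> x * (indicator {a..b} x *\<^sub>R f x)) \<le> norm (B * (indicator {a..b} x *\<^sub>R f x))"
      using B by (intro AE_I2) (fastforce simp: abs_mult indicator_def intro!: mult_right_mono)
  qed measurable
  then show ?thesis
    by (simp add: set_integrable_def mult_ac)
qed

text \<open>Change of variables on each branch: \<open>rinv\<close> maps [-1,1] onto [0,1], and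
  \<open>\<lambda>x. - rinv (- x)\<close> maps it onto [-1,0].\<close>

lemma transfer_duality:
  assumes [measurable]: "\<psi> \<in> borel_measurable borel" and B: "\<And>x. x \<in> {-1..1} \<Longrightarrow> \<bar>\<psi> x\<bar> \<le> B"
    and f: "continuous_on {-1..1} f"
  shows "(LBINT x:{-1..1}. \<psi> (g1 x) * f x) = (LBINT x:{-1..1}. \<psi> x * transfer f x)"
proof -
  let ?h = "\<lambda>x. \<psi> (g1 x) * f x"
  have bg: "\<bar>\<psi> (g1 x)\<bar> \<le> B" if "x \<in> {-1..1}" for x
    using B g1_mem[OF that] by blast
  have ints: "set_integrable lborel {a..b} ?h" if "{a..b} \<subseteq> {-1..1}" for a b
    using that bg by (intro set_integrable_bounded_mult[where B = B] continuous_on_subset[OF f]) auto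
  have c1: "continuous_on {-1..1} (\<lambda>x. drinv (- x))"
    by (auto intro!: continuous_on_compose2[OF continuous_on_drinv] continuous_intros)
  have R: "(LBINT x:{0..1}. ?h x) = (LBINT x:{-1..1}. ?h (rinv x) * drinv x)"
    and RI: "set_integrable lborel {-1..1} (\<lambda>x. ?h (rinv x) * drinv x)"
    using integral_substitution(2)[of rinv "- 1" 1 ?h drinv] integral_substitution(1)[of rinv "- 1" 1 ?h drinv]
      ints[of 0 1] DERIV_rinv drinv_pos
    by (auto simp: set_lebesgue_integral_def mult_ac continuous_on_drinv less_imp_le)
  have N: "(LBINT x:{-1..0}. ?h x) = (LBINT x:{-1..1}. ?h (- rinv (- x)) * drinv (- x))"
    and NI: "set_integrable lborel {-1..1} (\<lambda>x. ?h (- rinv (- x)) * drinv (- x))"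
    using integral_substitution(2)[of "\<lambda>x. - rinv (- x)" "- 1" 1 ?h "\<lambda>x. drinv (- x)"]
      integral_substitution(1)[of "\<lambda>x. - rinv (- x)" "- 1" 1 ?h "\<lambda>x. drinv (- x)"]
      ints[of "-1" 0] c1 drinv_pos DERIV_minus_rinv_minus
    by (auto simp: set_lebesgue_integral_def mult_ac less_imp_le)
  have "(LBINT x:{-1..1}. ?h x) = (LBINT x:{-1..0} \<union> {0..1}. ?h x)"
    by (rule arg_cong[where f = "\<lambda>A. set_lebesgue_integral lborel A ?h"]) auto
  also have "\<dots> = (LBINT x:{-1..0}. ?h x) + (LBINT x:{0..1}. ?h x)"
  proof (rule set_integral_Un_AE)
    have "AE x in lborel. x \<noteq> (0::real)"
      by (rule AE_lborel_singleton)
    then show "AE x in lborel. \<not> (x \<in> {-1..0::real} \<and> x \<in> {0..1})"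
      by eventually_elim auto
  qed (use ints in auto)
  also have "\<dots> = (LBINT x:{-1..1}. ?h (rinv x) * drinv x + ?h (- rinv (- x)) * drinv (- x))"
    using RI NI by (simp add: R N set_integral_add)
  \<comment> \<open>The integrands may differ at -1, where \<open>g1 (rinv x) = x\<close> fails; a
    single point carries no mass.\<close>
  also have "\<dots> = (LBINT x:{-1..1}. \<psi> x * transfer f x)"
    unfolding set_lebesgue_integral_def
    by (rule integral_discrete_difference[where X = "{-1}"])
       (auto simp: g1_rinv g1_minus_rinv transfer_def algebra_simps indicator_def)
  finally show ?thesis .
qed

section \<open>Iterated densities\<close>

lemma continuous_le_zero_at_1:
  fixes h :: "real \<Rightarrow> real"
  assumes "continuous_on {0..1} h" "\<And>t. 0 < t \<Longrightarrow> t < 1 \<Longrightarrow> h t \<le> 0"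
  shows "h 1 \<le> 0"
  by (rule continuous_le_on_closure[where S = "{0<..<1}" and f = h]) (simp_all add: assms)

text \<open>Scaling both points by \<open>t < 1\<close> moves them into the open interval, where the
  series compare termwise; continuity then allows \<open>t\<close> to tend to 1.\<close>

lemma pos_series_mono_closed:
  assumes f: "pos_series f" and c: "continuous_on {-1..1} f" and "\<bar>x\<bar> \<le> y" "y \<le> 1"
  shows "\<bar>f x\<bar> \<le> f y"
proof -
  have "continuous_on {0..1} (\<lambda>t. \<bar>f (t * x)\<bar> - f (t * y))"
  proof (intro continuous_intros continuous_on_compose2[OF c])
    have "\<bar>t * x\<bar> \<le> 1 * 1" "\<bar>t * y\<bar> \<le> 1 * 1" if "t \<in> {0..1}" for t
      using that assms unfolding abs_mult by (intro mult_mono; simp)+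
    then show "(\<lambda>t. t * x) ` {0..1} \<subseteq> {-1..1}" "(\<lambda>t. t * y) ` {0..1} \<subseteq> {-1..1}"
      by (auto simp: abs_le_iff)
  qed
  moreover have "\<bar>f (t * x)\<bar> - f (t * y) \<le> 0" if "0 < t" "t < 1" for t
  proof -
    have "t * y \<le> t * 1"
      using that assms by (intro mult_left_mono) auto
    also have "\<dots> < 1"
      using that by simp
    finally have "t * y < 1" .
    moreover have "\<bar>t * x\<bar> \<le> t * y"
      using that assms(3) by (simp add: abs_mult)
    ultimately show ?thesis
      using pos_series_mono[OF f, of "t * x" "t * y"] by linarith
  qed
  ultimately show ?thesis
    using continuous_le_zero_at_1[of "\<lambda>t. \<bar>f (t * x)\<bar> - f (t * y)"] by simp
qed

lemma pos_series_nonneg_closed: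
  "pos_series f \<Longrightarrow> continuous_on {-1..1} f \<Longrightarrow> x \<in> {0..1} \<Longrightarrow> 0 \<le> f x"
  using pos_series_mono_closed[of f x x] abs_ge_zero[of "f x"] by simp

lemma exists_primitive:
  fixes f :: "real \<Rightarrow> real"
  assumes "continuous_on {-1..1} f"
  obtains F where "F 0 = 0" "\<And>x. x \<in> {-1..1} \<Longrightarrow> (F has_real_derivative f x) (at x within {-1..1})"
proof -
  obtain F where F: "\<And>x. x \<in> {-1..1} \<Longrightarrow> (F has_real_derivative f x) (at x within {-1..1})"
    using antiderivative_continuous[OF assms] by (auto simp: has_real_derivative_iff_has_vector_derivative)
  show thesis
    by (rule that[of "\<lambda>x. F x - F 0"]) (auto intro!: derivative_eq_intros F)
qed

lemma DERIV_at_inside: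
  fixes F :: "real \<Rightarrow> real"
  assumes "\<And>x. x \<in> {-1..1} \<Longrightarrow> (F has_real_derivative f x) (at x within {-1..1})" "\<bar>x\<bar> < 1"
  shows "(F has_real_derivative f x) (at x)"
  using assms(1)[of x] assms(2) at_within_Icc_at[of "-1" x 1] by (auto simp: abs_less_iff)

lemma continuous_on_primitive:
  fixes F :: "real \<Rightarrow> real"
  assumes "\<And>x. x \<in> {-1..1} \<Longrightarrow> (F has_real_derivative f x) (at x within {-1..1})"
  shows "continuous_on {-1..1} F"
  using assms by (meson DERIV_continuous_on)

lemma integral_eq_primitive:
  fixes F :: "real \<Rightarrow> real"
  assumes "\<And>x. x \<in> {-1..1} \<Longrightarrow> (F has_real_derivative f x) (at x within {-1..1})" "0 \<le> a" "a \<le> b" "b \<le> 1"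
  shows "(f has_integral (F b - F a)) {a..b}"
proof (rule fundamental_theorem_of_calculus)
  fix x assume "x \<in> {a..b}"
  then show "(F has_vector_derivative f x) (at x within {a..b})"
    using assms(2-) has_field_derivative_subset[OF assms(1)[of x], of "{a..b}"]
    by (auto simp: has_real_derivative_iff_has_vector_derivative)
qed (use assms in auto)

section \<open>Parity and mass under the transfer operator\<close>

definition even_fun :: "(real \<Rightarrow> real) \<Rightarrow> bool" where
  "even_fun f \<longleftrightarrow> (\<forall>x. f (- x) = f x)"

definition odd_fun :: "(real \<Rightarrow> real) \<Rightarrow> bool" where
  "odd_fun f \<longleftrightarrow> (\<forall>x. f (- x) = - f x)"

text \<open>Since parity is defined on the whole real line, this rewriting holds for every
  \<open>x\<close> without a domain condition.\<close>

lemma transfer_of_even: "even_fun f \<Longrightarrow> transfer f x = f (rinv x) * drinv x + f (rinv (- x)) * drinv (- x)"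
  by (simp add: transfer_def even_fun_def)

lemma transfer_of_odd: "odd_fun f \<Longrightarrow> transfer f x = f (rinv x) * drinv x - f (rinv (- x)) * drinv (- x)"
  by (simp add: transfer_def odd_fun_def)

lemma even_fun_transfer: "even_fun f \<Longrightarrow> even_fun (transfer f)"
  by (subst even_fun_def) (simp add: transfer_of_even)

lemma odd_fun_transfer: "odd_fun f \<Longrightarrow> odd_fun (transfer f)"
  by (subst odd_fun_def) (simp add: transfer_of_odd)

lemma even_fun_transfer_funpow: "even_fun f \<Longrightarrow> even_fun ((transfer ^^ k) f)"
  by (induction k) (auto intro: even_fun_transfer)

lemma odd_fun_transfer_funpow: "odd_fun f \<Longrightarrow> odd_fun ((transfer ^^ k) f)"
  by (induction k) (auto intro: odd_fun_transfer)

lemma pos_series_branch: "pos_series f \<Longrightarrow> pos_series (\<lambda>x. f (rinv x) * drinv x)"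
  by (intro pos_series_mult pos_series_rinv_compose pos_series_drinv)

lemma pos_series_transfer_even:
  assumes "even_fun f" "pos_series f"
  shows "pos_series (transfer f)"
  using pos_series_even_part[OF pos_series_branch[OF assms(2)]]
  by (rule pos_series_cong) (simp add: transfer_of_even assms)

lemma pos_series_transfer_odd:
  assumes "odd_fun f" "pos_series f"
  shows "pos_series (transfer f)"
proof -
  obtain h where "pos_series h"
    and *: "\<And>x. \<bar>x\<bar> < 1 \<Longrightarrow> f (rinv x) * drinv x - f (rinv (- x)) * drinv (- x) = x * h x"
    using pos_series_odd_part[OF pos_series_branch[OF assms(2)]] by metis
  then have "pos_series (\<lambda>x. x * h x)"
    by (intro pos_series_mult pos_series_ident)
  then show ?thesis
    by (rule pos_series_cong) (simp add: transfer_of_odd assms *)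
qed

lemma pos_series_transfer_odd_funpow: "odd_fun f \<Longrightarrow> pos_series f \<Longrightarrow> pos_series ((transfer ^^ k) f)"
  by (induction k) (auto intro: pos_series_transfer_odd odd_fun_transfer_funpow)

lemma continuous_on_branch:
  assumes "continuous_on {-1..1} f"
  shows "continuous_on {-1..1} (\<lambda>x. f (rinv x) * drinv x)"
    "continuous_on {-1..1} (\<lambda>x. f (rinv (- x)) * drinv (- x))"
proof -
  have "\<And>x. x \<in> {-1..1} \<Longrightarrow> rinv x \<in> {-1..1}"
    using rinv_bounds by (meson atLeastAtMost_iff dual_order.trans neg_le_0_iff_le zero_le_one)
  then show *: "continuous_on {-1..1} (\<lambda>x. f (rinv x) * drinv x)"
    by (intro continuous_on_mult continuous_on_drinv continuous_on_compose2[OF assms] continuous_on_rinv) auto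
  show "continuous_on {-1..1} (\<lambda>x. f (rinv (- x)) * drinv (- x))"
    by (rule continuous_on_compose2[OF *, of _ uminus]) (auto intro: continuous_intros)
qed

lemma integral_branch:
  assumes "continuous_on {-1..1} f" "c \<in> {-1..1}"
  shows "((\<lambda>x. f (rinv x) * drinv x) has_integral integral {rinv c..1} f) {c..1}"
proof -
  have "((\<lambda>x. drinv x *\<^sub>R f (rinv x)) has_integral integral {rinv c..rinv 1} f) {c..1}"
  proof (rule has_integral_substitution[OF _ _ _ assms(1)])
    show "rinv ` {c..1} \<subseteq> {-1..1}"
    proof
      fix y assume "y \<in> rinv ` {c..1}"
      then obtain x where "x \<in> {c..1}" "y = rinv x"
        by blast
      then show "y \<in> {-1..1}"
        using rinv_bounds[of x] assms(2) by auto
    qed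
  qed (use assms rinv_mono[of c 1] in \<open>auto intro: DERIV_rinv\<close>)
  then show ?thesis
    by (simp add: mult.commute)
qed

text \<open>By evenness \<open>transfer f x = F x + F (- x)\<close> with \<open>F\<close> the
  right-branch term, so the integral over [0,1] unfolds to that of \<open>F\<close> over [-1,1],
  which \<open>rinv\<close> carries onto [0,1].\<close>

lemma integral_transfer_even:
  assumes "even_fun f" "continuous_on {-1..1} f"
  shows "integral {0..1} (transfer f) = integral {0..1} f"
proof -
  let ?F = "\<lambda>x. f (rinv x) * drinv x"
  have c: "continuous_on {-1..1} ?F"
    using continuous_on_branch assms by blast
  have i: "?F integrable_on {0..1}" "?F integrable_on {-1..0}" "?F integrable_on {-1..1}"
    by (auto intro!: integrable_continuous_real intro: continuous_on_subset[OF c])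
  have i': "(\<lambda>x. ?F (- x)) integrable_on {0..1}"
    by (auto intro!: integrable_continuous_real intro: continuous_on_subset[OF continuous_on_branch(2)[OF assms(2)]])
  have "integral {0..1} (transfer f) = integral {0..1} (\<lambda>x. ?F x + ?F (- x))"
    by (simp add: transfer_of_even[OF assms(1), abs_def])
  also have "\<dots> = integral {0..1} ?F + integral {0..1} (\<lambda>x. ?F (- x))"
    using i i' by (intro Henstock_Kurzweil_Integration.integral_add)
  also have "integral {0..1} (\<lambda>x. ?F (- x)) = integral {-1..0} ?F"
    using Henstock_Kurzweil_Integration.integral_reflect_real[of 0 "-1" ?F] by simp
  also have "integral {0..1} ?F + integral {-1..0} ?F = integral {-1..1} ?F"
    using i Henstock_Kurzweil_Integration.integral_combine[where a = "-1" and b = 1 and c = 0 and f = ?F] by simp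
  also have "\<dots> = integral {0..1} f"
    using integral_branch[OF assms(2), of "-1"] by (simp add: has_integral_iff)
  finally show ?thesis .
qed

text \<open>For an odd function with nonnegative coefficients the left branch only subtracts on
  [0,1]. Dropping it leaves the right branch, whose substitution moves the endpoint \<open>c\<close>
  to \<open>rinv c\<close>.\<close>

lemma integral_transfer_odd_le:
  assumes "odd_fun u" "pos_series u" "continuous_on {-1..1} u" "c \<in> {0..1}"
  shows "integral {c..1} ((transfer ^^ k) u) \<le> integral {(rinv ^^ k) c..1} u"
  using assms(4)
proof (induction k arbitrary: c)
  case (Suc k)
  define v where "v = (transfer ^^ k) u"
  have v: "odd_fun v" "pos_series v" "continuous_on {-1..1} v"
    using assms by (auto simp: v_def intro: odd_fun_transfer_funpow pos_series_transfer_odd_funpow continuous_on_transfer_funpow)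
  have "integral {c..1} (transfer v) \<le> integral {c..1} (\<lambda>x. v (rinv x) * drinv x)"
  proof (rule integral_le)
    show "transfer v integrable_on {c..1}" "(\<lambda>x. v (rinv x) * drinv x) integrable_on {c..1}"
      using v Suc.prems
      by (auto intro!: integrable_continuous_real intro: continuous_on_subset[OF continuous_on_transfer] continuous_on_subset[OF continuous_on_branch(1)])
    show "transfer v x \<le> v (rinv x) * drinv x" if "x \<in> {c..1}" for x
      using that Suc.prems rinv_bounds[of "- x"] drinv_pos[of "- x"] pos_series_nonneg_closed[OF v(2,3), of "rinv (- x)"]
      by (simp add: transfer_of_odd[OF v(1)])
  qed
  also have "\<dots> = integral {rinv c..1} v"
    using integral_branch[OF v(3), of c] Suc.prems by (simp add: has_integral_iff)
  also have "\<dots> \<le> integral {(rinv ^^ k) (rinv c)..1} u"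
    unfolding v_def using Suc.prems rinv_bounds[of c] by (intro Suc.IH) auto
  finally show ?case
    by (simp add: v_def funpow_swap1)
qed simp

text \<open>The density with respect to \<open>m\<close> of the image of \<open>m\<close> under
  \<open>g1 ^^ N\<close>. By evenness its Lebesgue integral over [0,1] is 1.\<close>

definition dens :: "nat \<Rightarrow> real \<Rightarrow> real" where
  "dens N = (transfer ^^ N) (\<lambda>_. 1)"

lemma dens_0 [simp]: "dens 0 = (\<lambda>_. 1)"
  by (simp add: dens_def)

lemma dens_Suc: "dens (Suc N) = transfer (dens N)"
  by (simp add: dens_def)

lemma even_dens: "even_fun (dens N)"
  unfolding dens_def by (intro even_fun_transfer_funpow) (simp add: even_fun_def)

lemma continuous_on_dens: "continuous_on {-1..1} (dens N)"
  unfolding dens_def by (intro continuous_on_transfer_funpow) auto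

lemma pos_series_dens: "pos_series (dens N)"
  by (induction N) (auto simp: dens_Suc intro: pos_series_const pos_series_transfer_even even_dens)

lemma integral_dens: "integral {0..1} (dens N) = 1"
  by (induction N) (auto simp: dens_Suc integral_transfer_even even_dens continuous_on_dens)

lemma dens_ge: "x \<in> {-1..1} \<Longrightarrow> dens N 0 \<le> dens N x"
  using pos_series_mono_closed[OF pos_series_dens continuous_on_dens, of 0 "\<bar>x\<bar>" N] even_dens[of N]
  by (cases "x < 0") (auto simp: even_fun_def)

lemma dens_le: "x \<in> {-1..1} \<Longrightarrow> dens N x \<le> dens N 1"
  using pos_series_mono_closed[OF pos_series_dens continuous_on_dens, of x 1 N] by (auto simp: abs_le_iff)

lemma dens_nonneg: "x \<in> {-1..1} \<Longrightarrow> 0 \<le> dens N x"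
  using dens_ge[of x N] pos_series_nonneg[OF pos_series_dens, of 0 N] by simp

lemma dens_0_le_1: "dens N 0 \<le> 1"
proof -
  have "integral {0..1::real} (\<lambda>_. dens N 0) \<le> integral {0..1} (dens N)"
    by (rule integral_le)
      (auto intro!: integrable_continuous_real dens_ge intro: continuous_on_subset[OF continuous_on_dens])
  then show ?thesis
    by (simp add: integral_dens)
qed

text \<open>At the fixed point 1 the inverse right branch has derivative 1, so the value grows only
  by the left-branch inflow from 0, at most 1 per step.\<close>

lemma dens_1_le: "dens N 1 \<le> 1 + real N"
proof (induction N)
  case (Suc N)
  have "dens (Suc N) 1 = dens N 1 * drinv 1 + dens N 0 * drinv (-1)"
    by (simp add: dens_Suc transfer_of_even[OF even_dens])
  also have "dens N 1 * drinv 1 \<le> dens N 1 * 1"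
    by (intro mult_left_mono dens_nonneg drinv_bounds) auto
  also have "dens N 0 * drinv (-1) \<le> 1 * 1"
    by (intro mult_mono dens_0_le_1 drinv_bounds less_imp_le[OF drinv_pos]) auto
  finally show ?case
    using Suc by simp
qed auto

text \<open>After one more step the mass of \<open>[c, 1]\<close> consists of the former mass of
  \<open>[rinv c, 1]\<close> and an inflow through the left branch. The inflow is at least
  \<open>(1 - c) * dens N 0 / 3\<close>, because the density is minimal at 0 and
  \<open>drinv\<close> is at least 1/3. Unrolling gives the sum, with \<open>j\<close> counting the
  steps since the inflow.\<close>

lemma integral_dens_ge:
  assumes "c \<in> {0..1}"
  shows "(\<Sum>j<N. (1 - (rinv ^^ j) c) * dens (N - Suc j) 0 / 3) \<le> integral {c..1} (dens N)"
  using assms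
proof (induction N arbitrary: c)
  case 0
  then show ?case by (simp add: integral_nonneg)
next
  case (Suc N)
  have i: "(\<lambda>x. dens N (rinv x) * drinv x) integrable_on {c..1}"
    using integral_branch[OF continuous_on_dens, of c] Suc.prems by (auto simp: has_integral_iff)
  have "(\<Sum>j<Suc N. (1 - (rinv ^^ j) c) * dens (Suc N - Suc j) 0 / 3)
      = (\<Sum>j<N. (1 - (rinv ^^ j) (rinv c)) * dens (N - Suc j) 0 / 3) + (1 - c) * dens N 0 / 3"
    by (simp add: sum.lessThan_Suc_shift funpow_swap1 del: sum.lessThan_Suc)
  also have "(\<Sum>j<N. (1 - (rinv ^^ j) (rinv c)) * dens (N - Suc j) 0 / 3) \<le> integral {rinv c..1} (dens N)"
    using Suc.prems rinv_bounds[of c] by (intro Suc.IH) auto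
  also have "\<dots> = integral {c..1} (\<lambda>x. dens N (rinv x) * drinv x)"
    using integral_branch[OF continuous_on_dens, of c] Suc.prems by (simp add: has_integral_iff)
  also have "(1 - c) * dens N 0 / 3 = integral {c..1} (\<lambda>_. dens N 0 / 3)"
    using Suc.prems by simp
  also have "integral {c..1} (\<lambda>x. dens N (rinv x) * drinv x) + integral {c..1} (\<lambda>_. dens N 0 / 3)
      = integral {c..1} (\<lambda>x. dens N (rinv x) * drinv x + dens N 0 / 3)"
    using i by (intro Henstock_Kurzweil_Integration.integral_add[symmetric]) auto
  also have "\<dots> \<le> integral {c..1} (dens (Suc N))"
  proof (rule integral_le)
    show "(\<lambda>x. dens N (rinv x) * drinv x + dens N 0 / 3) integrable_on {c..1}"
      using i by (intro Henstock_Kurzweil_Integration.integrable_add) auto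
    show "dens (Suc N) integrable_on {c..1}"
      using Suc.prems by (auto intro!: integrable_continuous_real intro: continuous_on_subset[OF continuous_on_dens])
    fix x assume x: "x \<in> {c..1}"
    have "dens N 0 * (1 / 3) \<le> dens N (rinv (- x)) * drinv (- x)"
      using x Suc.prems rinv_bounds[of "- x"] drinv_bounds(1)[of "- x"]
      by (intro mult_mono dens_ge dens_nonneg) auto
    then show "dens N (rinv x) * drinv x + dens N 0 / 3 \<le> dens (Suc N) x"
      by (simp add: dens_Suc transfer_of_even[OF even_dens])
  qed
  finally show ?case by simp
qed

section \<open>Even functions: primitives divided by a weight\<close>

text \<open>Below 1 the omitted terms are nonnegative, so the truncation is at most
  \<open>C x\<close>; letting \<open>x\<close> tend to 1 gives the endpoint. The first coefficients
  may have any sign, and \<open>d\<close> allows for a series starting at a higher power.\<close>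

lemma power_series_partial_sum_le:
  fixes c :: "nat \<Rightarrow> real"
  assumes s: "\<And>x. 0 < x \<Longrightarrow> x < 1 \<Longrightarrow> (\<lambda>k. c k * x ^ (k + d)) sums C x"
    and C: "continuous_on {0..1} C" and c: "\<And>k. K < k \<Longrightarrow> 0 \<le> c k"
  shows "(\<Sum>k\<le>K. c k) \<le> C 1"
proof -
  have "continuous_on {0..1} (\<lambda>x. (\<Sum>k\<le>K. c k * x ^ (k + d)) - C x)"
    by (intro continuous_intros C)
  moreover have "(\<Sum>k\<le>K. c k * x ^ (k + d)) - C x \<le> 0" if "0 < x" "x < 1" for x
  proof -
    have "(\<lambda>k. c k * x ^ (k + d)) sums C x"
      using that by (intro s) auto
    then have "summable (\<lambda>k. c k * x ^ (k + d))" "(\<Sum>k. c k * x ^ (k + d)) = C x"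
      by (auto simp: sums_iff)
    moreover have "(\<Sum>k\<in>{..K}. c k * x ^ (k + d)) \<le> (\<Sum>k. c k * x ^ (k + d))"
      using calculation(1) that c by (intro sum_le_suminf) auto
    ultimately have "(\<Sum>k\<in>{..K}. c k * x ^ (k + d)) \<le> C x"
      by simp
    then show ?thesis
      by simp
  qed
  ultimately show ?thesis
    using continuous_le_zero_at_1[of "\<lambda>x. (\<Sum>k\<le>K. c k * x ^ (k + d)) - C x"] by simp
qed

text \<open>Each summand is the integral over [0,1] of one term of the series, and the primitive of
  \<open>f\<close> supplies the bound at the endpoint.\<close>

lemma mass_partial_sum_le:
  assumes a: "\<And>x. \<bar>x\<bar> < 1 \<Longrightarrow> (\<lambda>k. a k * x ^ k) sums f x" "\<And>k. 0 \<le> a k"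
    and f: "continuous_on {-1..1} f"
  shows "(\<Sum>k\<le>K. a k / real (Suc k)) \<le> integral {0..1} f"
proof -
  obtain F where F: "F 0 = 0" "\<And>x. x \<in> {-1..1} \<Longrightarrow> (F has_real_derivative f x) (at x within {-1..1})"
    using exists_primitive[OF f] by metis
  have "(\<Sum>k\<le>K. a k / real (Suc k)) \<le> F 1"
  proof (rule power_series_partial_sum_le[where d = 1])
    show "(\<lambda>k. a k / real (Suc k) * x ^ (k + 1)) sums F x" if "0 < x" "x < 1" for x
      using power_series_antiderivative[OF a(1) DERIV_at_inside[OF F(2)], of x] that F(1) by simp
    show "continuous_on {0..1} F"
      using continuous_on_primitive[OF F(2)] by (rule continuous_on_subset) auto
  qed (use a in auto)
  also have "F 1 = integral {0..1} f"
    using integral_eq_primitive[OF F(2), of 0 1] F(1) by (simp add: has_integral_iff)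
  finally show ?thesis .
qed

text \<open>Chebyshev's correlation inequality for the increasing weights \<^term>\<open>real (Suc k) / real (k + m + 1)\<close>,
  comparing the truncated series with the full integrals.\<close>

lemma moment_partial_sum_le:
  assumes a: "\<And>x. \<bar>x\<bar> < 1 \<Longrightarrow> (\<lambda>k. a k * x ^ k) sums f x" "\<And>k. 0 \<le> a k"
    and f: "continuous_on {-1..1} f" and f1: "integral {0..1} f = 1"
  shows "(\<Sum>k\<le>K. a k / real (k + m + 1)) \<le> integral {0..1} (\<lambda>x. x ^ m * f x) * (\<Sum>k\<le>K. a k / real (Suc k))"
proof -
  \<comment> \<open>\<open>\<rho> k\<close> is the ratio of the \<open>k\<close>-th contribution to
    the \<open>m\<close>-th moment and the \<open>k\<close>-th contribution to the mass.
    \<open>R\<close> and \<open>Q\<close> are truncations of moment and mass, whose full values are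
    \<open>mean\<close> and 1.\<close>
  define \<rho> where "\<rho> k = real (Suc k) / real (k + m + 1)" for k
  define R where "R = (\<Sum>k\<le>K. a k / real (k + m + 1))"
  define Q where "Q = (\<Sum>k\<le>K. a k / real (Suc k))"
  define mean where "mean = integral {0..1} (\<lambda>x. x ^ m * f x)"
  have fm: "continuous_on {-1..1} (\<lambda>x. x ^ m * f x)"
    by (intro continuous_intros f)
  obtain F where F: "F 0 = 0" "\<And>x. x \<in> {-1..1} \<Longrightarrow> (F has_real_derivative f x) (at x within {-1..1})"
    using exists_primitive[OF f] by metis
  obtain G where G: "G 0 = 0" "\<And>x. x \<in> {-1..1} \<Longrightarrow> (G has_real_derivative x ^ m * f x) (at x within {-1..1})"
    using exists_primitive[OF fm] by metis
  have mono: "\<rho> j \<le> \<rho> k" if "j \<le> k" for j k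
  proof -
    have eq: "\<rho> k = 1 - real m / real (k + m + 1)" for k
      by (simp add: \<rho>_def field_simps)
    show ?thesis
      unfolding eq using that by (intro diff_left_mono divide_left_mono) auto
  qed
  have sG: "(\<lambda>k. a k / real (k + m + 1) * x ^ (k + m + 1)) sums G x" if x: "0 < x" "x < 1" for x
  proof -
    have "(\<lambda>k. (if m \<le> k then a (k - m) else 0) * x ^ k) sums (x ^ m * f x)" if "\<bar>x\<bar> < 1" for x
    proof -
      have "(\<lambda>k. (if m \<le> k + m then a (k + m - m) else 0) * x ^ (k + m)) sums (x ^ m * f x)"
        using sums_mult[OF a(1)[OF that], of "x ^ m"] by (simp add: power_add mult_ac)
      then show ?thesis
        by (subst (asm) sums_iff_shift) simp
    qed
    from power_series_antiderivative[of "\<lambda>k. if m \<le> k then a (k - m) else 0", OF this DERIV_at_inside[OF G(2)], of x]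
    have "(\<lambda>k. (if m \<le> k then a (k - m) else 0) / real (Suc k) * x ^ Suc k) sums G x"
      using x G(1) by simp
    then have "(\<lambda>k. (if m \<le> k + m then a (k + m - m) else 0) / real (Suc (k + m)) * x ^ Suc (k + m)) sums G x"
      by (subst sums_iff_shift) simp
    then show ?thesis
      by simp
  qed
  have sF: "(\<lambda>k. a k / real (Suc k) * x ^ Suc k) sums F x" if "0 < x" "x < 1" for x
    using power_series_antiderivative[OF a(1) DERIV_at_inside[OF F(2)], of x] that F(1) by simp
  \<comment> \<open>Past \<open>K\<close> the ratio is at least \<open>\<rho> K\<close>, so the tail
    of the moment minus \<open>\<rho> K\<close> times the mass is nonnegative. The factor
    \<open>x ^ m\<close> on \<open>F\<close> aligns the powers and equals 1 at the endpoint.\<close>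
  have "(\<Sum>k\<le>K. a k / real (Suc k) * (\<rho> k - \<rho> K)) \<le> G 1 - \<rho> K * (1 ^ m * F 1)"
  proof (rule power_series_partial_sum_le[where d = "m + 1"])
    fix x :: real assume x: "0 < x" "x < 1"
    have "(\<lambda>k. a k / real (k + m + 1) * x ^ (k + m + 1) - \<rho> K * (x ^ m * (a k / real (Suc k) * x ^ Suc k)))
        sums (G x - \<rho> K * (x ^ m * F x))"
      by (intro sums_diff sums_mult sG sF x)
    moreover have "a k / real (k + m + 1) * x ^ (k + m + 1) - \<rho> K * (x ^ m * (a k / real (Suc k) * x ^ Suc k))
        = a k / real (Suc k) * (\<rho> k - \<rho> K) * x ^ (k + (m + 1))" for k
    proof -
      have "a k / real (k + m + 1) = a k / real (Suc k) * \<rho> k"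
        by (simp add: \<rho>_def)
      moreover have "x ^ (k + m + 1) = x ^ m * x ^ Suc k" "x ^ (k + (m + 1)) = x ^ m * x ^ Suc k"
        by (simp_all add: power_add)
      ultimately show ?thesis
        by (simp only: ring_distribs mult_ac)
    qed
    ultimately show "(\<lambda>k. a k / real (Suc k) * (\<rho> k - \<rho> K) * x ^ (k + (m + 1))) sums (G x - \<rho> K * (x ^ m * F x))"
      by simp
  next
    show "continuous_on {0..1} (\<lambda>x. G x - \<rho> K * (x ^ m * F x))"
      by (intro continuous_intros; rule continuous_on_subset[OF continuous_on_primitive[OF F(2)]]
          continuous_on_subset[OF continuous_on_primitive[OF G(2)]]) auto
    show "0 \<le> a k / real (Suc k) * (\<rho> k - \<rho> K)" if "K < k" for k
      using that mono[of K k] a(2) by simp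
  qed
  moreover have "F 1 = 1" "G 1 = mean"
    using integral_eq_primitive[OF F(2), of 0 1] integral_eq_primitive[OF G(2), of 0 1] F(1) G(1) f1
    by (auto simp: has_integral_iff mean_def)
  moreover have "(\<Sum>k\<le>K. a k / real (Suc k) * (\<rho> k - \<rho> K)) = R - \<rho> K * Q"
    by (simp add: R_def Q_def \<rho>_def right_diff_distrib sum_subtractf sum_distrib_left mult_ac del: of_nat_Suc)
  ultimately have 1: "R - \<rho> K * Q \<le> mean - \<rho> K"
    by simp
  have 2: "Q \<le> 1"
    using mass_partial_sum_le[OF a f, of K] by (simp add: Q_def f1)
  have 3: "0 \<le> Q"
    unfolding Q_def using a(2) by (intro sum_nonneg) auto
  have 4: "R \<le> \<rho> K * Q"
  proof -
    have "a k / real (k + m + 1) \<le> \<rho> K * (a k / real (Suc k))" if "k \<le> K" for k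
    proof -
      have "a k / real (k + m + 1) = \<rho> k * (a k / real (Suc k))"
        by (simp add: \<rho>_def)
      also have "\<dots> \<le> \<rho> K * (a k / real (Suc k))"
        using mono[OF that] a(2) by (intro mult_right_mono) auto
      finally show ?thesis .
    qed
    then show ?thesis
      unfolding R_def Q_def sum_distrib_left by (intro sum_mono) auto
  qed
  \<comment> \<open>Only the part of \<open>R\<close> multiplied by the missing mass
    \<open>1 - Q\<close> is enlarged, to \<open>\<rho> K * Q\<close>; the bracket that then appears
    is at most \<open>mean\<close>.\<close>
  have "R = R * Q + R * (1 - Q)"
    by (simp add: algebra_simps)
  also have "\<dots> \<le> R * Q + \<rho> K * Q * (1 - Q)"
    using 2 4 by (intro add_left_mono mult_right_mono) auto
  also have "\<dots> = (R + \<rho> K * (1 - Q)) * Q"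
    by (simp add: algebra_simps)
  also have "\<dots> \<le> mean * Q"
    using 1 3 by (intro mult_right_mono) (auto simp: algebra_simps)
  finally show ?thesis
    by (simp add: R_def Q_def mean_def)
qed

section \<open>The weight and the functions divided by it\<close>

definition weight :: "real \<Rightarrow> real" where
  "weight x = x * (1 - x) * (2 - x) * (3 - x)"

text \<open>With \<open>y = rinv x\<close> the factors pair up as
  \<open>(1 - y) * (2 - y) = 1 - x\<close> and \<open>y * (3 - y) = 1 + x\<close>. The product is
  even in \<open>x\<close>, so both branches share it.\<close>

lemma weight_rinv:
  assumes "x \<in> {-1..1}"
  shows "weight (rinv x) = 1 - x\<^sup>2"
proof -
  have "(1 - rinv x) * (2 - rinv x) = 1 - x" "rinv x * (3 - rinv x) = 1 + x"
    using rinv_quadratic[of x] assms by (auto simp: algebra_simps power2_eq_square)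
  then have "weight (rinv x) = (1 - x) * (1 + x)"
    unfolding weight_def by (metis mult.assoc mult.commute)
  then show ?thesis
    by (simp add: algebra_simps power2_eq_square)
qed

text \<open>Only \<open>[0, 1)\<close> is constrained; for \<open>x\<close> there, both
  \<open>rinv x\<close> and \<open>rinv (- x)\<close> lie in it again.\<close>

definition weighted :: "(real \<Rightarrow> real) \<Rightarrow> bool" where
  "weighted G \<longleftrightarrow> (\<exists>h. pos_series h \<and> (\<forall>x. 0 \<le> x \<longrightarrow> x < 1 \<longrightarrow> G x = weight x * h x))"

lemma weighted_nonneg:
  assumes "weighted G" "0 \<le> x" "x < 1"
  shows "0 \<le> G x"
  using assms by (auto simp: weighted_def weight_def pos_series_nonneg)

text \<open>The shared factor \<open>1 - x\<^sup>2\<close> comes out and leaves a difference of the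
  form \<open>x * k x\<close>. Since \<open>x * (1 - x\<^sup>2) = weight x * (1 + x) / ((2 - x) * (3
  - x))\<close>, the new cofactor again has nonnegative coefficients.\<close>

lemma weighted_step:
  assumes "weighted G"
  shows "weighted (\<lambda>x. G (rinv x) - G (rinv (- x)))"
proof -
  obtain h where h: "pos_series h" "\<And>x. 0 \<le> x \<Longrightarrow> x < 1 \<Longrightarrow> G x = weight x * h x"
    using assms by (auto simp: weighted_def)
  obtain k where k: "pos_series k" "\<And>x. \<bar>x\<bar> < 1 \<Longrightarrow> h (rinv x) - h (rinv (- x)) = x * k x"
    using pos_series_odd_part[OF pos_series_rinv_compose[OF h(1)]] by metis
  have "pos_series (\<lambda>x. (1 + x) * (1 / (2 - x)) * (1 / (3 - x)) * k x)"
    by (intro pos_series_mult pos_series_add pos_series_const pos_series_ident pos_series_inverse_diff k) auto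
  moreover have "G (rinv x) - G (rinv (- x)) = weight x * ((1 + x) * (1 / (2 - x)) * (1 / (3 - x)) * k x)"
    if "0 \<le> x" "x < 1" for x
  proof -
    have "rinv (- x) \<le> rinv x"
      using that by (intro rinv_mono) auto
    then have "G (rinv x) - G (rinv (- x)) = (1 - x\<^sup>2) * (h (rinv x) - h (rinv (- x)))"
      using that rinv_bounds[of x] rinv_bounds[of "- x"] rinv_less_1[of x]
      by (simp add: h(2) weight_rinv right_diff_distrib)
    also have "\<dots> = (1 - x\<^sup>2) * (x * k x)"
      using that by (subst k) auto
    also have "\<dots> = weight x * ((1 + x) * (1 / (2 - x)) * (1 / (3 - x)) * k x)"
    proof -
      have "2 - x \<noteq> 0" "3 - x \<noteq> 0"
        using that by auto
      then show ?thesis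
        unfolding weight_def by (simp add: divide_simps) (simp add: algebra_simps power2_eq_square)
    qed
    finally show ?thesis .
  qed
  ultimately show ?thesis
    unfolding weighted_def by blast
qed

text \<open>Here \<open>G x = x * s x\<close>, where \<open>s\<close> has the coefficients
  \<open>- b k / real (Suc k)\<close>. Dividing by \<open>1 - x\<close> replaces these by their
  partial sums, which \<open>le\<close> makes nonnegative; the factors \<open>1 / (2 - x)\<close>
  and \<open>1 / (3 - x)\<close> preserve this.\<close>

lemma weighted_primitive:
  assumes b: "\<And>x. \<bar>x\<bar> < 1 \<Longrightarrow> (\<lambda>k. b k * x ^ k) sums f x"
    and G: "\<And>x. \<bar>x\<bar> < 1 \<Longrightarrow> (G has_real_derivative - f x) (at x)" "G 0 = 0"
    and le: "\<And>K. (\<Sum>k\<le>K. b k / real (Suc k)) \<le> 0"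
  shows "weighted G"
proof -
  define c where "c k = - (b k / real (Suc k))" for k
  define s where "s x = (\<Sum>k. c k * x ^ k)" for x
  have xs: "(\<lambda>k. x * (c k * x ^ k)) sums G x" if "\<bar>x\<bar> < 1" for x
    using power_series_antiderivative[of "\<lambda>k. - b k" "\<lambda>x. - f x" G x] G that sums_minus[OF b]
    by (simp add: c_def mult_ac)
  have cs: "(\<lambda>k. c k * x ^ k) sums s x" if "\<bar>x\<bar> < 1" for x
    using sums_summable[OF xs[OF that]] unfolding s_def
    by (cases "x = 0") (auto intro!: summable_sums simp: summable_cmult_iff)
  have Gs: "G x = x * s x" if "\<bar>x\<bar> < 1" for x
    using xs[OF that] sums_mult[OF cs[OF that], of x] by (rule sums_unique2)
  have geo: "(\<lambda>k. 1 * x ^ k) sums (1 / (1 - x))" if "\<bar>x\<bar> < 1" for x :: real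
    using geometric_sums[of x] that by simp
  have "pos_series (\<lambda>x. s x * (1 / (1 - x)))"
  proof (rule pos_seriesI)
    show "0 \<le> (\<Sum>i\<le>k. c i * 1)" for k
      using le[of k] by (simp add: c_def sum_negf)
  qed (rule power_series_mult[OF cs geo])
  then have "pos_series (\<lambda>x. s x * (1 / (1 - x)) * (1 / (2 - x)) * (1 / (3 - x)))"
    by (rule pos_series_mult[OF pos_series_mult[OF _ pos_series_inverse_diff] pos_series_inverse_diff]) auto
  moreover have "G x = weight x * (s x * (1 / (1 - x)) * (1 / (2 - x)) * (1 / (3 - x)))" if "0 \<le> x" "x < 1" for x
    using that by (simp add: Gs weight_def)
  ultimately show ?thesis
    unfolding weighted_def by blast
qed

section \<open>The transfer operator acting on primitives\<close>

definition prim_step :: "(real \<Rightarrow> real) \<Rightarrow> real \<Rightarrow> real" where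
  "prim_step G = (\<lambda>x. G (rinv x) - G (rinv (- x)))"

lemma weighted_funpow: "weighted G \<Longrightarrow> weighted ((prim_step ^^ k) G)"
  by (induction k) (auto simp: prim_step_def dest: weighted_step)

lemma prim_step_funpow_0: "G 0 = 0 \<Longrightarrow> (prim_step ^^ k) G 0 = 0"
  by (induction k) (auto simp: prim_step_def)

lemma prim_step_funpow_1: "G 0 = 0 \<Longrightarrow> G 1 = 0 \<Longrightarrow> (prim_step ^^ k) G 1 = 0"
  by (induction k) (auto simp: prim_step_def prim_step_funpow_0)

lemma weighted_funpow_nonneg:
  assumes "weighted G" "G 0 = 0" "G 1 = 0" "x \<in> {0..1}"
  shows "0 \<le> (prim_step ^^ k) G x"
  using assms weighted_nonneg[OF weighted_funpow[OF assms(1)], of x k] prim_step_funpow_1[of G k]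
  by (cases "x = 1") auto

text \<open>Nonnegativity of the iterates allows the subtracted branch to be dropped at every step,
  leaving only the orbit of \<open>x\<close> under \<open>rinv\<close>.\<close>

lemma prim_step_funpow_le:
  assumes "weighted G" "G 0 = 0" "G 1 = 0" "x \<in> {0..1}"
  shows "(prim_step ^^ k) G x \<le> G ((rinv ^^ k) x)"
  using assms(4)
proof (induction k arbitrary: x)
  case (Suc k)
  have "(prim_step ^^ Suc k) G x \<le> (prim_step ^^ k) G (rinv x)"
    using weighted_funpow_nonneg[OF assms(1-3), of "rinv (- x)" k] rinv_bounds[of "- x"] Suc.prems
    by (simp add: prim_step_def)
  also have "\<dots> \<le> G ((rinv ^^ k) (rinv x))"
    using Suc.prems rinv_bounds[of x] by (intro Suc.IH) auto
  finally show ?case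
    by (simp add: funpow_swap1)
qed simp

text \<open>Chain rule, where evenness identifies \<open>f (rinv (- x))\<close> with the left-branch
  value \<open>f (- rinv (- x))\<close>.\<close>

lemma DERIV_prim_step:
  assumes f: "even_fun f" and G: "\<And>x. x \<in> {-1..1} \<Longrightarrow> (G has_real_derivative - f x) (at x within {-1..1})"
    and x: "x \<in> {-1..1}"
  shows "(prim_step G has_real_derivative - transfer f x) (at x within {-1..1})"
proof -
  have sub: "rinv ` {-1..1} \<subseteq> {-1..1}" "(\<lambda>x. rinv (- x)) ` {-1..1} \<subseteq> {-1..1}"
    using rinv_bounds by (auto simp: image_subset_iff) (smt (verit) atLeastAtMost_iff)+
  have "((\<lambda>x. rinv (- x)) has_real_derivative - drinv (- x)) (at x within {-1..1})"
    using DERIV_minus[OF DERIV_minus_rinv_minus[OF x, of "{-1..1}"]] by simp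
  moreover have "(rinv has_real_derivative drinv x) (at x within {-1..1})"
    using x by (rule DERIV_rinv)
  moreover have "rinv x \<in> {-1..1}" "rinv (- x) \<in> {-1..1}"
    using sub x by blast+
  ultimately have "((\<lambda>x. G (rinv x) - G (rinv (- x))) has_real_derivative
      (- f (rinv x) * drinv x - (- f (rinv (- x)) * - drinv (- x)))) (at x within {-1..1})"
    using sub by (intro DERIV_diff DERIV_image_chain[unfolded o_def] has_field_derivative_subset[OF G]) auto
  then show ?thesis
    by (simp add: prim_step_def transfer_of_even[OF f])
qed

lemma DERIV_prim_step_funpow:
  assumes f: "even_fun f" and G: "\<And>x. x \<in> {-1..1} \<Longrightarrow> (G has_real_derivative - f x) (at x within {-1..1})"
    and x: "x \<in> {-1..1}"
  shows "((prim_step ^^ k) G has_real_derivative - (transfer ^^ k) f x) (at x within {-1..1})"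
  using x
proof (induction k arbitrary: x)
  case (Suc k)
  show ?case
    using DERIV_prim_step[OF even_fun_transfer_funpow[OF f] Suc.IH Suc.prems] by simp
qed (auto intro: G)

text \<open>Integration by parts: the boundary terms vanish because the iterated primitive is 0 at
  both endpoints, and the remaining integrand lies between 0 and \<open>l * M\<close>. For
  \<open>l = 0\<close> the factor \<open>l\<close> removes the term with truncated exponent
  \<open>l - 1\<close>.\<close>

lemma integral_power_transfer:
  assumes f: "even_fun f" and G: "\<And>x. x \<in> {-1..1} \<Longrightarrow> (G has_real_derivative - f x) (at x within {-1..1})"
    and w: "weighted G" "G 0 = 0" "G 1 = 0" and M: "\<And>x. x \<in> {0..1} \<Longrightarrow> G ((rinv ^^ k) x) \<le> M"
  shows "0 \<le> integral {0..1} (\<lambda>x. x ^ l * (transfer ^^ k) f x)"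
    "integral {0..1} (\<lambda>x. x ^ l * (transfer ^^ k) f x) \<le> real l * M"
proof -
  define u where "u = (transfer ^^ k) f"
  define H where "H = (prim_step ^^ k) G"
  have H: "(H has_real_derivative - u x) (at x within {-1..1})" if "x \<in> {-1..1}" for x
    unfolding H_def u_def using f G that by (rule DERIV_prim_step_funpow)
  have Hc: "continuous_on {0..1} H"
    using continuous_on_primitive[OF H] by (rule continuous_on_subset) auto
  have i: "(\<lambda>x. real l * x ^ (l - 1) * H x) integrable_on {0..1}"
    by (intro integrable_continuous_real continuous_intros Hc)
  have "((\<lambda>x. real l * x ^ (l - 1) * H x - x ^ l * u x) has_integral (1 ^ l * H 1 - 0 ^ l * H 0)) {0..1}"
  proof (rule fundamental_theorem_of_calculus)
    fix x :: real assume x: "x \<in> {0..1}"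
    have "(H has_real_derivative - u x) (at x within {0..1})"
      using x by (intro has_field_derivative_subset[OF H]) auto
    then have "((\<lambda>x. x ^ l * H x) has_real_derivative (real l * x ^ (l - 1) * H x - x ^ l * u x)) (at x within {0..1})"
      by (auto intro!: derivative_eq_intros)
    then show "((\<lambda>x. x ^ l * H x) has_vector_derivative (real l * x ^ (l - 1) * H x - x ^ l * u x)) (at x within {0..1})"
      by (simp add: has_real_derivative_iff_has_vector_derivative)
  qed simp
  then have "((\<lambda>x. real l * x ^ (l - 1) * H x - x ^ l * u x) has_integral 0) {0..1}"
    using w by (simp add: H_def prim_step_funpow_0 prim_step_funpow_1)
  from has_integral_diff[OF integrable_integral[OF i] this]
  have eq: "integral {0..1} (\<lambda>x. x ^ l * u x) = integral {0..1} (\<lambda>x. real l * x ^ (l - 1) * H x)"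
    by (simp add: has_integral_iff)
  have H0: "0 \<le> H x" "H x \<le> M" if "x \<in> {0..1}" for x
    using weighted_funpow_nonneg[OF w that, of k] prim_step_funpow_le[OF w that, of k] M[OF that] by (auto simp: H_def)
  show "0 \<le> integral {0..1} (\<lambda>x. x ^ l * (transfer ^^ k) f x)"
    unfolding u_def[symmetric] eq using i H0 by (intro Henstock_Kurzweil_Integration.integral_nonneg) auto
  have "integral {0..1} (\<lambda>x. real l * x ^ (l - 1) * H x) \<le> integral {0..1} (\<lambda>x::real. real l * M)"
  proof (rule integral_le)
    fix x :: real assume x: "x \<in> {0..1}"
    have "x ^ (l - 1) * H x \<le> 1 * M"
      using x H0[OF x] by (intro mult_mono power_le_one) auto
    then show "real l * x ^ (l - 1) * H x \<le> real l * M"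
      using mult_left_mono[of "x ^ (l - 1) * H x" M "real l"] by (simp add: mult.assoc)
  qed (use i in auto)
  then show "integral {0..1} (\<lambda>x. x ^ l * (transfer ^^ k) f x) \<le> real l * M"
    unfolding u_def[symmetric] eq by simp
qed

section \<open>Covariances and means of powers\<close>

lemma leb_I_eq: "leb_I = density (lebesgue_on {-1..1}) (\<lambda>_. ennreal (1 / 2))"
proof -
  have "emeasure (lebesgue_on {-1..1::real}) {-1..1} = 2"
    by (simp add: emeasure_restrict_space)
  moreover have "(1::ennreal) / 2 = ennreal (1 / 2)"
    by (metis divide_ennreal ennreal_1 ennreal_numeral zero_le_one zero_less_numeral zero_le_numeral)
  ultimately have eq: "indicator {-1..1} x / emeasure (lebesgue_on {-1..1::real}) {-1..1} = ennreal (1 / 2)"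
    if "x \<in> space (lebesgue_on {-1..1})" for x :: real
    using that by simp
  have "(\<lambda>x. indicator {-1..1} x / emeasure (lebesgue_on {-1..1::real}) {-1..1}) \<in> borel_measurable (lebesgue_on {-1..1::real})"
    by (subst measurable_cong[OF eq]) auto
  then show ?thesis
    unfolding leb_I_def uniform_measure_def using borel_measurable_const AE_I2[OF eq] by (rule density_cong)
qed

lemma prob_space_leb_I: "prob_space leb_I"
  unfolding leb_I_def by (rule prob_space_uniform_measure) (auto simp: emeasure_restrict_space)

lemma space_leb_I [simp]: "space leb_I = {-1..1}"
  by (simp add: leb_I_def)

lemma sets_leb_I [measurable_cong, simp]: "sets leb_I = sets (lebesgue_on {-1..1})"
  by (simp add: leb_I_def)

lemma borel_measurable_leb_I: "F \<in> borel_measurable borel \<Longrightarrow> F \<in> borel_measurable leb_I"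
proof -
  assume "F \<in> borel_measurable borel"
  then have "F \<in> borel_measurable (lebesgue_on {-1..1})"
    by (intro measurable_restrict_space1 measurable_completion) simp
  then show ?thesis
    by (simp cong: measurable_cong_sets)
qed

lemma integral_leb_I:
  fixes F :: "real \<Rightarrow> real"
  assumes "F \<in> borel_measurable borel"
  shows "(\<integral>x. F x \<partial>leb_I) = (LBINT x:{-1..1}. F x) / 2"
proof -
  have "F \<in> borel_measurable (lebesgue_on {-1..1})"
    using assms by (intro measurable_restrict_space1 measurable_completion) simp
  then have "(\<integral>x. F x \<partial>leb_I) = (\<integral>x. (1 / 2) *\<^sub>R F x \<partial>lebesgue_on {-1..1})"
    unfolding leb_I_eq by (intro integral_density) auto
  also have "\<dots> = (\<integral>x. F x \<partial>lebesgue_on {-1..1}) / 2"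
    by simp
  also have "(\<integral>x. F x \<partial>lebesgue_on {-1..1}) = (\<integral>x. indicator {-1..1} x *\<^sub>R F x \<partial>lebesgue)"
    by (rule integral_restrict_space) simp
  also have "\<dots> = (LBINT x:{-1..1}. F x)"
    unfolding set_lebesgue_integral_def using assms by (intro integral_completion) simp
  finally show ?thesis .
qed

lemma transfer_funpow_duality:
  assumes [measurable]: "\<psi> \<in> borel_measurable borel" and B: "\<And>x. x \<in> {-1..1} \<Longrightarrow> \<bar>\<psi> x\<bar> \<le> B"
    and f: "continuous_on {-1..1} f"
  shows "(LBINT x:{-1..1}. \<psi> ((g1 ^^ k) x) * f x) = (LBINT x:{-1..1}. \<psi> x * (transfer ^^ k) f x)"
  using f
proof (induction k arbitrary: f)
  case (Suc k)
  have "(LBINT x:{-1..1}. \<psi> ((g1 ^^ Suc k) x) * f x) = (LBINT x:{-1..1}. \<psi> ((g1 ^^ k) (g1 x)) * f x)"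
    by (simp add: funpow_swap1)
  also have "\<dots> = (LBINT x:{-1..1}. \<psi> ((g1 ^^ k) x) * transfer f x)"
    by (rule transfer_duality[where \<psi> = "\<lambda>x. \<psi> ((g1 ^^ k) x)" and B = B])
       (use Suc.prems B g1_funpow_mem in auto)
  also have "\<dots> = (LBINT x:{-1..1}. \<psi> x * (transfer ^^ k) (transfer f) x)"
    by (intro Suc.IH continuous_on_transfer Suc.prems)
  finally show ?case
    by (simp add: funpow_swap1)
qed simp

lemma power_bounded_1: "x \<in> {-1..1} \<Longrightarrow> \<bar>x ^ m\<bar> \<le> (1::real)"
  by (simp add: power_abs power_le_one abs_le_iff)

lemma LBINT_eq_integral:
  fixes f :: "real \<Rightarrow> real"
  assumes "continuous_on {-1..1} f"
  shows "(LBINT x:{-1..1}. f x) = integral {-1..1} f"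
  using assms by (intro set_borel_integral_eq_integral borel_integrable_atLeastAtMost')

text \<open>Duality is used twice: \<open>N\<close> steps turn the constant density into
  \<open>dens N\<close>, then \<open>k\<close> steps act on the product
  \<open>x ^ m * dens N x\<close>. The division by 2 normalizes the measure.\<close>

lemma expectation_power_mult:
  "(\<integral>x. ((g1 ^^ N) x) ^ m * ((g1 ^^ (N + k)) x) ^ l \<partial>leb_I)
    = integral {-1..1} (\<lambda>x. x ^ l * (transfer ^^ k) (\<lambda>x. x ^ m * dens N x) x) / 2"
proof -
  have c: "continuous_on {-1..1} (\<lambda>x. x ^ m * dens N x)"
    by (intro continuous_intros continuous_on_dens)
  have "(\<integral>x. ((g1 ^^ N) x) ^ m * ((g1 ^^ (N + k)) x) ^ l \<partial>leb_I)
      = (LBINT x:{-1..1}. ((g1 ^^ N) x) ^ m * ((g1 ^^ k) ((g1 ^^ N) x)) ^ l * 1) / 2"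
    by (subst integral_leb_I) (simp_all add: funpow_add add.commute[of N])
  also have "(LBINT x:{-1..1}. ((g1 ^^ N) x) ^ m * ((g1 ^^ k) ((g1 ^^ N) x)) ^ l * 1)
      = (LBINT x:{-1..1}. x ^ m * ((g1 ^^ k) x) ^ l * (transfer ^^ N) (\<lambda>_. 1) x)"
  proof (rule transfer_funpow_duality[where \<psi> = "\<lambda>x. x ^ m * ((g1 ^^ k) x) ^ l" and B = "1 * 1"])
    fix x :: real assume "x \<in> {-1..1}"
    then show "\<bar>x ^ m * ((g1 ^^ k) x) ^ l\<bar> \<le> 1 * 1"
      unfolding abs_mult using g1_funpow_mem[of x k] by (intro mult_mono power_bounded_1) auto
  qed auto
  also have "\<dots> = (LBINT x:{-1..1}. ((g1 ^^ k) x) ^ l * (x ^ m * dens N x))"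
    by (simp add: dens_def mult_ac)
  also have "\<dots> = (LBINT x:{-1..1}. x ^ l * (transfer ^^ k) (\<lambda>x. x ^ m * dens N x) x)"
    by (rule transfer_funpow_duality[where \<psi> = "\<lambda>x. x ^ l" and B = 1]) (use c in \<open>auto intro: power_bounded_1[unfolded atLeastAtMost_iff]\<close>)
  also have "\<dots> = integral {-1..1} (\<lambda>x. x ^ l * (transfer ^^ k) (\<lambda>x. x ^ m * dens N x) x)"
    by (intro LBINT_eq_integral continuous_intros continuous_on_transfer_funpow continuous_on_dens)
  finally show ?thesis .
qed

lemma expectation_power:
  "(\<integral>x. ((g1 ^^ N) x) ^ l \<partial>leb_I) = integral {-1..1} (\<lambda>x. x ^ l * dens N x) / 2"
  using expectation_power_mult[of 0 0 N l] by (simp add: dens_def)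

section \<open>Parity and moments\<close>

lemma integral_even:
  fixes f :: "real \<Rightarrow> real"
  assumes "even_fun f" "continuous_on {-1..1} f"
  shows "integral {-1..1} f = 2 * integral {0..1} f"
proof -
  have "f integrable_on {-1..1}"
    using assms(2) by (rule integrable_continuous_real)
  then have "integral {-1..1} f = integral {-1..0} f + integral {0..1} f"
    by (intro Henstock_Kurzweil_Integration.integral_combine[symmetric]) auto
  moreover have "integral {-1..0} f = integral {0..1} f"
    using Henstock_Kurzweil_Integration.integral_reflect_real[of 0 "-1" f] assms(1) by (simp add: even_fun_def)
  ultimately show ?thesis by simp
qed

lemma integral_odd:
  fixes f :: "real \<Rightarrow> real"
  assumes "odd_fun f"
  shows "integral {-1..1} f = 0"
  using Henstock_Kurzweil_Integration.integral_reflect_real[of 1 "-1" f] assms by (simp add: odd_fun_def)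

lemma even_fun_mult: "even_fun f \<Longrightarrow> even_fun h \<Longrightarrow> even_fun (\<lambda>x. f x * h x)"
  and odd_fun_mult: "odd_fun f \<Longrightarrow> even_fun h \<Longrightarrow> odd_fun (\<lambda>x. f x * h x)"
  and odd_fun_mult': "even_fun f \<Longrightarrow> odd_fun h \<Longrightarrow> odd_fun (\<lambda>x. f x * h x)"
  and even_fun_mult': "odd_fun f \<Longrightarrow> odd_fun h \<Longrightarrow> even_fun (\<lambda>x. f x * h x)"
  and even_fun_power: "even m \<Longrightarrow> even_fun (\<lambda>x. x ^ m)"
  and odd_fun_power: "odd m \<Longrightarrow> odd_fun (\<lambda>x. x ^ m)"
  by (simp_all add: even_fun_def odd_fun_def)

text \<open>For even \<open>m\<close> the doubling by symmetry cancels the normalization 1/2, so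
  this half-interval integral is the expectation of the \<open>m\<close>-th power at time
  \<open>N\<close>.\<close>

definition moment :: "nat \<Rightarrow> nat \<Rightarrow> real" where
  "moment m N = integral {0..1} (\<lambda>x. x ^ m * dens N x)"

lemma expectation_power_eq: "(\<integral>x. ((g1 ^^ N) x) ^ m \<partial>leb_I) = (if even m then moment m N else 0)"
proof -
  have "continuous_on {-1..1} (\<lambda>x. x ^ m * dens N x)"
    by (intro continuous_intros continuous_on_dens)
  then show ?thesis
    unfolding expectation_power moment_def
    using integral_even[OF even_fun_mult[OF even_fun_power even_dens], of m N]
      integral_odd[OF odd_fun_mult[OF odd_fun_power even_dens], of m N]
    by auto
qed

lemma moment_bounds: "0 \<le> moment m N" "moment m N \<le> 1"
proof -
  have i: "(\<lambda>x. x ^ m * dens N x) integrable_on {0..1}" "dens N integrable_on {0..1}"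
    by (auto intro!: integrable_continuous_real continuous_intros intro: continuous_on_subset[OF continuous_on_dens])
  show "0 \<le> moment m N"
    unfolding moment_def using i
    by (intro Henstock_Kurzweil_Integration.integral_nonneg) (auto intro!: mult_nonneg_nonneg dens_nonneg)
  have "moment m N \<le> integral {0..1} (dens N)"
    unfolding moment_def
  proof (rule integral_le)
    fix x :: real assume x: "x \<in> {0..1}"
    then show "x ^ m * dens N x \<le> dens N x"
      using mult_right_mono[of "x ^ m" 1 "dens N x"] dens_nonneg[of x N] by (auto simp: power_le_one)
  qed (use i in auto)
  then show "moment m N \<le> 1"
    by (simp add: integral_dens)
qed

section \<open>Covariance bounds for powers\<close>

text \<open>\<open>x ^ m * dens N x\<close> is odd with nonnegative coefficients, so its iterates
  stay nonnegative on [0,1]. Their mass there is at most the initial mass on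
  \<open>[(rinv ^^ k) 0, 1]\<close>, an interval of length at most \<open>2 / (k + 2)\<close> on
  which the density is at most \<open>1 + N\<close>.\<close>

lemma covariance_odd_power:
  assumes "odd m" "odd l"
  shows "\<bar>integral {0..1} (\<lambda>x. x ^ l * (transfer ^^ k) (\<lambda>x. x ^ m * dens N x) x)\<bar>
    \<le> 2 * (1 + real N) / (real k + 2)"
proof -
  define u where "u = (\<lambda>x. x ^ m * dens N x)"
  define v where "v = (transfer ^^ k) u"
  have u: "odd_fun u" "pos_series u" "continuous_on {-1..1} u"
    using assms unfolding u_def
    by (auto intro!: odd_fun_mult odd_fun_power even_dens pos_series_mult pos_series_power pos_series_ident pos_series_dens
        continuous_intros continuous_on_dens)
  have v: "pos_series v" "continuous_on {-1..1} v"
    using u unfolding v_def by (auto intro: pos_series_transfer_odd_funpow continuous_on_transfer_funpow)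
  have v0: "0 \<le> v x" if "x \<in> {0..1}" for x
    using pos_series_nonneg_closed[OF v that] .
  have c: "(rinv ^^ k) 0 \<in> {0..1}"
    by (rule rinv_funpow_bounds) simp
  have i: "v integrable_on {0..1}" "(\<lambda>x. x ^ l * v x) integrable_on {0..1}" "u integrable_on {(rinv ^^ k) 0..1}"
    using c by (auto intro!: integrable_continuous_real continuous_intros continuous_on_subset[OF v(2)] continuous_on_subset[OF u(3)])
  have "0 \<le> integral {0..1} (\<lambda>x. x ^ l * v x)"
    using i v0 by (intro Henstock_Kurzweil_Integration.integral_nonneg) auto
  moreover have "integral {0..1} (\<lambda>x. x ^ l * v x) \<le> integral {0..1} v"
  proof (rule integral_le)
    fix x :: real assume x: "x \<in> {0..1}"
    then show "x ^ l * v x \<le> v x"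
      using mult_right_mono[of "x ^ l" 1 "v x"] v0[of x] by (auto simp: power_le_one)
  qed (use i in auto)
  moreover have "integral {0..1} v \<le> integral {(rinv ^^ k) 0..1} u"
    unfolding v_def using u by (intro integral_transfer_odd_le) auto
  moreover have "integral {(rinv ^^ k) 0..1} u \<le> integral {(rinv ^^ k) 0..1} (\<lambda>_. 1 + real N)"
  proof (rule integral_le)
    fix x assume "x \<in> {(rinv ^^ k) 0..1}"
    then have x: "x \<in> {0..1}"
      using c by auto
    then have "x ^ m * dens N x \<le> 1 * (1 + real N)"
      using dens_le[of x N] dens_1_le[of N] by (intro mult_mono dens_nonneg power_le_one) auto
    then show "u x \<le> 1 + real N"
      by (simp add: u_def)
  qed (use i in auto)
  moreover have "integral {(rinv ^^ k) 0..1} (\<lambda>_. 1 + real N) = (1 - (rinv ^^ k) 0) * (1 + real N)"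
    using c by simp
  moreover have "(1 - (rinv ^^ k) 0) * (1 + real N) \<le> 2 / (real k + 2) * (1 + real N)"
    by (intro mult_right_mono one_minus_rinv_funpow_le) auto
  ultimately show ?thesis
    by (simp add: u_def v_def)
qed

text \<open>Multiplication by \<open>x ^ m\<close> shifts the coefficients by \<open>m\<close>, so
  \<open>moment_partial_sum_le\<close> provides the partial-sum condition of
  \<open>weighted_primitive\<close>.\<close>

lemma weighted_centred_power:
  assumes G: "\<And>x. x \<in> {-1..1} \<Longrightarrow> (G has_real_derivative - (x ^ m * dens N x - moment m N * dens N x)) (at x within {-1..1})"
    "G 0 = 0"
  shows "weighted G"
proof -
  obtain a where a: "\<And>k. 0 \<le> a k" "\<And>x. \<bar>x\<bar> < 1 \<Longrightarrow> (\<lambda>k. a k * x ^ k) sums dens N x"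
    using pos_series_dens[of N] by (metis pos_series_def)
  define s where "s k = (if m \<le> k then a (k - m) else 0)" for k
  have s: "(\<lambda>k. s k * x ^ k) sums (x ^ m * dens N x)" if "\<bar>x\<bar> < 1" for x
  proof -
    have "(\<lambda>k. s (k + m) * x ^ (k + m)) sums (x ^ m * dens N x)"
      using sums_mult[OF a(2)[OF that], of "x ^ m"] by (simp add: power_add mult_ac s_def)
    then show ?thesis
      by (subst (asm) sums_iff_shift) (simp add: s_def)
  qed
  show ?thesis
  proof (rule weighted_primitive[where b = "\<lambda>k. s k - moment m N * a k" and f = "\<lambda>x. x ^ m * dens N x - moment m N * dens N x"])
    show "(\<lambda>k. (s k - moment m N * a k) * x ^ k) sums (x ^ m * dens N x - moment m N * dens N x)" if "\<bar>x\<bar> < 1" for x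
      using sums_diff[OF s[OF that] sums_mult[OF a(2)[OF that], of "moment m N"]] by (simp add: left_diff_distrib mult.assoc)
    show "(\<Sum>k\<le>K. (s k - moment m N * a k) / real (Suc k)) \<le> 0" for K
    proof -
      \<comment> \<open>Extending the range to \<open>K + m\<close> adds nonnegative terms; after
        the shift it contains precisely \<open>a 0\<close> to \<open>a K\<close>.\<close>
      have "(\<Sum>k\<le>K. s k / real (Suc k)) \<le> (\<Sum>k\<in>{..K + m}. s k / real (Suc k))"
        using a(1) by (intro sum_mono2) (auto simp: s_def)
      also have "\<dots> = (\<Sum>k\<in>{0 + m..K + m}. s k / real (Suc k))"
        by (intro sum.mono_neutral_right) (auto simp: s_def)
      also have "\<dots> = (\<Sum>k\<in>{0..K}. s (k + m) / real (Suc (k + m)))"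
        by (rule sum.shift_bounds_cl_nat_ivl)
      also have "\<dots> = (\<Sum>k\<le>K. a k / real (k + m + 1))"
        by (simp add: s_def atLeast0AtMost)
      also have "\<dots> \<le> moment m N * (\<Sum>k\<le>K. a k / real (Suc k))"
        unfolding moment_def by (rule moment_partial_sum_le[OF a(2,1) continuous_on_dens integral_dens])
      finally show ?thesis
        by (simp add: diff_divide_distrib sum_subtractf sum_distrib_left)
    qed
  qed (use G in \<open>auto intro: DERIV_at_inside\<close>)
qed

text \<open>Centring makes the integral over [0,1] zero, so the primitive \<open>G\<close> vanishes
  at both endpoints and \<open>integral_power_transfer\<close> applies. The bound on
  \<open>G t\<close> holds because it is the integral over \<open>[t, 1]\<close> of a function
  bounded above by \<open>1 + N\<close>.\<close>

lemma covariance_even_power: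
  assumes "even m"
  shows "\<bar>integral {0..1} (\<lambda>x. x ^ l * (transfer ^^ k) (\<lambda>x. x ^ m * dens N x - moment m N * dens N x) x)\<bar>
    \<le> real l * (2 * (1 + real N) / (real k + 2))"
proof -
  define b where "b = (\<lambda>x. x ^ m * dens N x - moment m N * dens N x)"
  have b: "even_fun b" "continuous_on {-1..1} b"
    using even_dens[of N] assms unfolding b_def
    by (auto simp: even_fun_def intro!: continuous_intros continuous_on_dens)
  have bi: "integral {0..1} b = 0"
  proof -
    have i: "(\<lambda>x. x ^ m * dens N x) integrable_on {0..1}" "(\<lambda>x. moment m N * dens N x) integrable_on {0..1}"
      by (auto intro!: integrable_continuous_real continuous_intros intro: continuous_on_subset[OF continuous_on_dens])
    then show ?thesis
      unfolding b_def using Henstock_Kurzweil_Integration.integral_diff[OF i]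
      by (simp add: integral_dens moment_def[symmetric])
  qed
  have "continuous_on {-1..1} (\<lambda>x. - b x)"
    using b by (intro continuous_intros)
  then obtain G where G: "G 0 = 0" "\<And>x. x \<in> {-1..1} \<Longrightarrow> (G has_real_derivative - b x) (at x within {-1..1})"
    using exists_primitive by metis
  have G1: "G 1 = 0"
    using integral_eq_primitive[OF G(2), of 0 1] G(1) bi by (auto simp: has_integral_iff)
  have w: "weighted G"
    using G unfolding b_def by (intro weighted_centred_power) auto
  have M: "G ((rinv ^^ k) x) \<le> 2 * (1 + real N) / (real k + 2)" if "x \<in> {0..1}" for x
  proof -
    define t where "t = (rinv ^^ k) x"
    have t: "t \<in> {0..1}"
      unfolding t_def using that by (rule rinv_funpow_bounds)
    have I: "((\<lambda>x. - b x) has_integral (G 1 - G t)) {t..1}"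
      using t by (intro integral_eq_primitive G(2)) auto
    from has_integral_neg[OF I] have "(b has_integral G t) {t..1}"
      by (simp add: G1)
    then have bint: "b integrable_on {t..1}" and "G t = integral {t..1} b"
      by (auto simp: has_integral_iff)
    note \<open>G t = integral {t..1} b\<close>
    also have "integral {t..1} b \<le> integral {t..1} (\<lambda>_. 1 + real N)"
    proof (rule integral_le)
      fix y assume "y \<in> {t..1}"
      then have y: "y \<in> {0..1}"
        using t by auto
      have "(y ^ m - moment m N) * dens N y \<le> 1 * (1 + real N)"
      proof (rule mult_mono)
        have "y ^ m \<le> 1"
          using y by (intro power_le_one) auto
        then show "y ^ m - moment m N \<le> 1"
          using moment_bounds(1)[of m N] by linarith
      qed (use y dens_le[of y N] dens_1_le[of N] dens_nonneg[of y N] in auto)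
      then show "b y \<le> 1 + real N"
        by (simp add: b_def left_diff_distrib)
    qed (use bint in auto)
    also have "\<dots> = (1 - t) * (1 + real N)"
      using t by simp
    also have "\<dots> \<le> 2 / (real k + 2) * (1 + real N)"
      unfolding t_def using that by (intro mult_right_mono one_minus_rinv_funpow_le) auto
    finally show ?thesis
      by (simp add: t_def)
  qed
  show ?thesis
    using integral_power_transfer[OF b(1) G(2) w G(1) G1 M, of l] by (simp add: b_def)
qed

lemma transfer_funpow_diff: "(transfer ^^ k) (\<lambda>x. f x - h x) = (\<lambda>x. (transfer ^^ k) f x - (transfer ^^ k) h x)"
  by (induction k) (auto simp: transfer_diff)

lemma transfer_funpow_mult: "(transfer ^^ k) (\<lambda>x. c * f x) = (\<lambda>x. c * (transfer ^^ k) f x)"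
  by (induction k) (auto simp: transfer_mult)

lemma transfer_funpow_dens: "(transfer ^^ k) (dens N) = dens (N + k)"
  unfolding dens_def add.commute[of N k] funpow_add by simp

text \<open>Powers of different parity are uncorrelated by symmetry. For equal parity the integral
  over [-1,1] is twice that over [0,1], and the two half-interval bounds apply; the factor
  \<open>1 + l\<close> covers both.\<close>

lemma Cov_power_le:
  "\<bar>Cov leb_I (\<lambda>x. ((g1 ^^ N) x) ^ m) (\<lambda>x. ((g1 ^^ (N + k)) x) ^ l)\<bar> \<le> (1 + real l) * (2 * (1 + real N) / (real k + 2))"
proof -
  let ?u = "\<lambda>x. x ^ m * dens N x"
  let ?b = "\<lambda>x. ?u x - moment m N * dens N x"
  let ?R = "2 * (1 + real N) / (real k + 2)"
  have R: "0 \<le> ?R" "?R \<le> (1 + real l) * ?R" "real l * ?R \<le> (1 + real l) * ?R"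
    by (auto simp: divide_simps algebra_simps)
  have u: "continuous_on {-1..1} ?u"
    by (intro continuous_intros continuous_on_dens)
  show ?thesis
  proof (cases "even m")
    case False
    then have "odd_fun ?u"
      by (intro odd_fun_mult odd_fun_power even_dens)
    then have o: "odd_fun ((transfer ^^ k) ?u)"
      by (rule odd_fun_transfer_funpow)
    have Cov: "Cov leb_I (\<lambda>x. ((g1 ^^ N) x) ^ m) (\<lambda>x. ((g1 ^^ (N + k)) x) ^ l)
        = integral {-1..1} (\<lambda>x. x ^ l * (transfer ^^ k) ?u x) / 2"
      using False unfolding Cov_def expectation_power_mult by (simp add: expectation_power_eq)
    show ?thesis
    proof (cases "even l")
      case True
      then have "odd_fun (\<lambda>x. x ^ l * (transfer ^^ k) ?u x)"
        using o by (intro odd_fun_mult' even_fun_power)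
      then show ?thesis
        unfolding Cov using R by (simp add: integral_odd)
    next
      case l: False
      have "even_fun (\<lambda>x. x ^ l * (transfer ^^ k) ?u x)"
        using o l by (intro even_fun_mult' odd_fun_power)
      moreover have "continuous_on {-1..1} (\<lambda>x. x ^ l * (transfer ^^ k) ?u x)"
        by (intro continuous_intros continuous_on_transfer_funpow continuous_on_dens)
      ultimately have "integral {-1..1} (\<lambda>x. x ^ l * (transfer ^^ k) ?u x) / 2 = integral {0..1} (\<lambda>x. x ^ l * (transfer ^^ k) ?u x)"
        by (simp add: integral_even)
      then show ?thesis
        unfolding Cov using covariance_odd_power[OF False l, of k N] R by linarith
    qed
  next
    case True
    have e: "even_fun ((transfer ^^ k) ?b)"
      using True even_dens[of N] by (intro even_fun_transfer_funpow) (auto simp: even_fun_def)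
    have c: "continuous_on {-1..1} (\<lambda>x. x ^ l * (transfer ^^ k) ?b x)"
      by (intro continuous_intros continuous_on_transfer_funpow continuous_on_dens)
    have i: "(\<lambda>x. x ^ l * (transfer ^^ k) ?u x) integrable_on {-1..1}"
      "(\<lambda>x. moment m N * (x ^ l * dens (N + k) x)) integrable_on {-1..1}"
      by (auto intro!: integrable_continuous_real continuous_intros continuous_on_transfer_funpow continuous_on_dens)
    \<comment> \<open>The mean times \<open>dens N\<close> evolves into the mean times
      \<open>dens (N + k)\<close>, which yields the product of the two expectations.\<close>
    have "(transfer ^^ k) ?b = (\<lambda>x. (transfer ^^ k) ?u x - moment m N * dens (N + k) x)"
      by (simp only: transfer_funpow_diff transfer_funpow_mult transfer_funpow_dens)
    then have "integral {-1..1} (\<lambda>x. x ^ l * (transfer ^^ k) ?b x)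
        = integral {-1..1} (\<lambda>x. x ^ l * (transfer ^^ k) ?u x - moment m N * (x ^ l * dens (N + k) x))"
      by (simp add: right_diff_distrib mult.left_commute)
    also have "\<dots> = integral {-1..1} (\<lambda>x. x ^ l * (transfer ^^ k) ?u x) - moment m N * integral {-1..1} (\<lambda>x. x ^ l * dens (N + k) x)"
      using Henstock_Kurzweil_Integration.integral_diff[OF i] by simp
    finally have Cov: "Cov leb_I (\<lambda>x. ((g1 ^^ N) x) ^ m) (\<lambda>x. ((g1 ^^ (N + k)) x) ^ l)
        = integral {-1..1} (\<lambda>x. x ^ l * (transfer ^^ k) ?b x) / 2"
      unfolding Cov_def expectation_power_mult expectation_power[of "N + k"]
      using True by (simp add: expectation_power_eq)
    show ?thesis
    proof (cases "even l")
      case True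
      then have "even_fun (\<lambda>x. x ^ l * (transfer ^^ k) ?b x)"
        using e by (intro even_fun_mult even_fun_power)
      then have "integral {-1..1} (\<lambda>x. x ^ l * (transfer ^^ k) ?b x) / 2 = integral {0..1} (\<lambda>x. x ^ l * (transfer ^^ k) ?b x)"
        using c by (simp add: integral_even)
      then show ?thesis
        unfolding Cov using covariance_even_power[OF \<open>even m\<close>, of l k N] R by linarith
    next
      case False
      then have "odd_fun (\<lambda>x. x ^ l * (transfer ^^ k) ?b x)"
        using e by (intro odd_fun_mult odd_fun_power)
      then show ?thesis
        unfolding Cov using R by (simp add: integral_odd)
    qed
  qed
qed

section \<open>Escape of mass to the endpoints\<close>

text \<open>For \<open>b = dens 1 - 1\<close> the \<open>N\<close>-th iterate at 0 is the increment
  \<open>dens (Suc N) 0 - dens N 0\<close>. The iterated primitive is nonnegative on [0,1] and 0 at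
  0, so its derivative there, which is minus that increment, cannot be negative.\<close>

lemma dens_0_decreasing: "dens (Suc N) 0 \<le> dens N 0"
proof -
  obtain a where a: "\<And>k. 0 \<le> a k" "\<And>x. \<bar>x\<bar> < 1 \<Longrightarrow> (\<lambda>k. a k * x ^ k) sums dens 1 x"
    using pos_series_dens[of 1] by (metis pos_series_def)
  define b where "b = (\<lambda>x. dens 1 x - 1)"
  have b: "even_fun b"
    using even_dens[of 1] by (simp add: b_def even_fun_def)
  have "continuous_on {-1..1} (\<lambda>x. - b x)"
    unfolding b_def by (intro continuous_intros continuous_on_dens)
  then obtain G where G: "G 0 = 0" "\<And>x. x \<in> {-1..1} \<Longrightarrow> (G has_real_derivative - b x) (at x within {-1..1})"
    using exists_primitive by metis
  have i: "dens 1 integrable_on {0..1}"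
    by (auto intro!: integrable_continuous_real intro: continuous_on_subset[OF continuous_on_dens])
  have "integral {0..1} b = 0"
    unfolding b_def using Henstock_Kurzweil_Integration.integral_diff[OF i integrable_const_ivl, of 1]
      integral_dens[of 1] by simp
  then have G1: "G 1 = 0"
    using integral_eq_primitive[OF G(2), of 0 1] G(1) by (auto simp: has_integral_iff)
  have w: "weighted G"
  proof (rule weighted_primitive[where b = "\<lambda>k. a k - (if k = 0 then 1 else 0)" and f = b])
    show "(\<lambda>k. (a k - (if k = 0 then 1 else 0)) * x ^ k) sums b x" if "\<bar>x\<bar> < 1" for x
    proof -
      have "(\<lambda>k. (if k = 0 then 1 else 0) * x ^ k) sums 1"
        using sums_single[of 0 "\<lambda>k. x ^ k"] by (simp add: if_distrib[of "\<lambda>t. t * _"] cong: if_cong)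
      from sums_diff[OF a(2)[OF that] this] show ?thesis
        by (simp add: b_def left_diff_distrib)
    qed
    \<comment> \<open>The truncated mass of \<open>dens 1\<close> is at most 1, and the constant
      removes exactly 1 from it.\<close>
    show "(\<Sum>k\<le>K. (a k - (if k = 0 then 1 else 0)) / real (Suc k)) \<le> 0" for K
    proof -
      have "(\<Sum>k\<le>K. (if k = 0 then 1 else 0) / real (Suc k)) = (\<Sum>k\<le>K. if k = 0 then 1 else 0)"
        by (intro sum.cong) auto
      then have "(\<Sum>k\<le>K. (if k = 0 then 1 else 0) / real (Suc k)) = 1"
        by simp
      then show ?thesis
        using mass_partial_sum_le[OF a(2,1) continuous_on_dens, of K] integral_dens[of 1]
        by (simp add: diff_divide_distrib sum_subtractf)
    qed
  qed (use G in \<open>auto intro: DERIV_at_inside\<close>)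
  have tb: "(transfer ^^ N) b 0 = dens (Suc N) 0 - dens N 0"
  proof -
    have "b = (\<lambda>x. dens 1 x - dens 0 x)"
      by (simp add: b_def)
    then show ?thesis
      using transfer_funpow_dens[of N 1] transfer_funpow_dens[of N 0] by (simp add: transfer_funpow_diff)
  qed
  show ?thesis
  proof (rule ccontr)
    assume "\<not> ?thesis"
    then have neg: "- (transfer ^^ N) b 0 < 0"
      by (simp add: tb)
    have "((prim_step ^^ N) G has_real_derivative - (transfer ^^ N) b 0) (at 0)"
      using DERIV_prim_step_funpow[OF b G(2), of _ N] by (intro DERIV_at_inside) auto
    from DERIV_neg_dec_right[OF this neg]
    obtain d where d: "d > 0" "\<And>h. h > 0 \<Longrightarrow> h < d \<Longrightarrow> (prim_step ^^ N) G (0 + h) < (prim_step ^^ N) G 0"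
      by blast
    \<comment> \<open>Halving stays strictly below \<open>d\<close>, and the minimum with 1 stays in
      [0,1].\<close>
    then have "(prim_step ^^ N) G (min (d / 2) 1) < 0"
      using d(2)[of "min (d / 2) 1"] prim_step_funpow_0[where G = G and k = N, OF G(1)] by auto
    then show False
      using weighted_funpow_nonneg[OF w G(1) G1, of "min (d / 2) 1" N] d(1) by auto
  qed
qed

text \<open>In \<open>integral_dens_ge\<close> with \<open>c = 0\<close> the total mass is 1, the
  factor for \<open>j\<close> elapsed steps is at least \<open>1 / (j + 1)\<close>, and by
  monotonicity every \<open>dens (N - Suc j) 0\<close> is at least \<open>dens N 0\<close>. Hence
  \<open>dens N 0\<close> times a harmonic number is at most 3.\<close>

lemma dens_0_tendsto_0: "(\<lambda>N. dens N 0) \<longlonglongrightarrow> 0"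
proof (rule tendsto_sandwich[where f = "\<lambda>_. 0" and h = "\<lambda>N. 3 / harm N"])
  have dec: "dens N 0 \<le> dens k 0" if "k \<le> N" for k N
    using that by (rule lift_Suc_antimono_le[of "\<lambda>N. dens N 0", OF dens_0_decreasing])
  have "dens N 0 * harm N \<le> 3" for N
  proof -
    have "dens N 0 * harm N = (\<Sum>j<N. dens N 0 * (1 / (real j + 1)))"
      unfolding harm_def sum_distrib_left One_nat_def
      by (subst sum.atLeast1_atMost_eq) (simp add: inverse_eq_divide add.commute)
    also have "\<dots> \<le> (\<Sum>j<N. 3 * ((1 - (rinv ^^ j) 0) * dens (N - Suc j) 0 / 3))"
    proof (rule sum_mono)
      fix j
      have "1 / (real j + 1) * dens N 0 \<le> (1 - (rinv ^^ j) 0) * dens (N - Suc j) 0"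
        by (intro mult_mono one_minus_rinv_funpow_ge dec dens_nonneg) (use rinv_funpow_bounds[of 0 j] in auto)
      then show "dens N 0 * (1 / (real j + 1)) \<le> 3 * ((1 - (rinv ^^ j) 0) * dens (N - Suc j) 0 / 3)"
        by simp
    qed
    also have "\<dots> = 3 * (\<Sum>j<N. (1 - (rinv ^^ j) 0) * dens (N - Suc j) 0 / 3)"
      by (rule sum_distrib_left[symmetric])
    also have "\<dots> \<le> 3"
      using integral_dens_ge[of 0 N] by (simp add: integral_dens)
    finally show ?thesis .
  qed
  then have "dens N 0 \<le> 3 / harm N" if "N > 0" for N
    using that harm_pos[of N] by (simp add: field_simps)
  then show "\<forall>\<^sub>F N in sequentially. dens N 0 \<le> 3 / harm N"
    using eventually_gt_at_top[of 0] by (rule eventually_mono[rotated])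
  show "(\<lambda>N. 3 / harm N :: real) \<longlonglongrightarrow> 0"
    by (rule real_tendsto_divide_at_top[OF tendsto_const harm_at_top])
qed (simp_all add: dens_nonneg)

text \<open>Each transfer step keeps the right-branch term with a factor \<open>drinv\<close> of at
  least 1/3. Smallness at 0 at time \<open>N + j\<close> therefore gives smallness at
  \<open>(rinv ^^ j) 0\<close> at time \<open>N\<close>.\<close>

lemma dens_rinv_funpow_le: "x \<in> {-1..1} \<Longrightarrow> dens N ((rinv ^^ j) x) \<le> 3 ^ j * dens (N + j) x"
proof (induction j arbitrary: x)
  case (Suc j)
  have r: "rinv x \<in> {-1..1}"
    using rinv_bounds[OF Suc.prems] by auto
  have "dens N ((rinv ^^ Suc j) x) \<le> 3 ^ j * dens (N + j) (rinv x)"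
    using Suc.IH[OF r] by (simp add: funpow_swap1)
  also have "dens (N + j) (rinv x) \<le> 3 * dens (N + Suc j) x"
  proof -
    have "dens (N + j) (rinv x) * (1 / 3) \<le> dens (N + j) (rinv x) * drinv x"
      using r Suc.prems by (intro mult_left_mono drinv_bounds dens_nonneg)
    moreover have "0 \<le> dens (N + j) (rinv (- x)) * drinv (- x)"
      using Suc.prems rinv_bounds[of "- x"] drinv_pos[of "- x"] by (intro mult_nonneg_nonneg dens_nonneg) auto
    ultimately show ?thesis
      by (simp add: dens_Suc transfer_of_even[OF even_dens])
  qed
  finally show ?case
    by simp
qed simp

text \<open>The density is nondecreasing on [0,1], so \<open>[0, c]\<close> carries mass at most
  \<open>dens N c\<close>; on the rest, \<open>x ^ m\<close> is at least
  \<open>c ^ m\<close>.\<close>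

lemma moment_ge:
  assumes c: "c \<in> {0..1}"
  shows "c ^ m * (1 - dens N c) \<le> moment m N"
proof -
  have i: "(\<lambda>x. x ^ m * dens N x) integrable_on {a..b}" "dens N integrable_on {a..b}"
    if "{a..b} \<subseteq> {-1..1}" for a b
    using that by (auto intro!: integrable_continuous_real continuous_intros intro: continuous_on_subset[OF continuous_on_dens])
  have sub: "{0..c} \<subseteq> {-1..1}" "{c..1} \<subseteq> {-1..1}" "{0..1::real} \<subseteq> {-1..1}"
    using c by auto
  have "integral {0..c} (dens N) \<le> integral {0..c} (\<lambda>_. dens N c)"
  proof (rule integral_le)
    fix x assume "x \<in> {0..c}"
    then show "dens N x \<le> dens N c"
      using pos_series_mono_closed[OF pos_series_dens continuous_on_dens, of x c N] c by auto
  qed (use i sub in auto)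
  also have "\<dots> \<le> dens N c"
    using c mult_right_mono[of c 1 "dens N c"] dens_nonneg[of c N] by simp
  finally have "1 - dens N c \<le> integral {c..1} (dens N)"
    using Henstock_Kurzweil_Integration.integral_combine[of 0 c 1 "dens N"] i(2)[OF sub(3)] c by (simp add: integral_dens)
  then have "c ^ m * (1 - dens N c) \<le> c ^ m * integral {c..1} (dens N)"
    using c by (intro mult_left_mono) auto
  also have "\<dots> = integral {c..1} (\<lambda>x. c ^ m * dens N x)"
    by simp
  also have "\<dots> \<le> integral {c..1} (\<lambda>x. x ^ m * dens N x)"
  proof (rule integral_le)
    show "(\<lambda>x. c ^ m * dens N x) integrable_on {c..1}"
      using sub(2) by (auto intro!: integrable_continuous_real continuous_intros intro: continuous_on_subset[OF continuous_on_dens])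
    show "c ^ m * dens N x \<le> x ^ m * dens N x" if "x \<in> {c..1}" for x
      using that c by (intro mult_right_mono power_mono dens_nonneg) auto
  qed (use i sub in auto)
  also have "\<dots> \<le> moment m N"
  proof -
    have "0 \<le> integral {0..c} (\<lambda>x. x ^ m * dens N x)"
      using i(1)[OF sub(1)] c by (intro Henstock_Kurzweil_Integration.integral_nonneg) (auto intro!: mult_nonneg_nonneg dens_nonneg)
    then show ?thesis
      unfolding moment_def
      using Henstock_Kurzweil_Integration.integral_combine[of 0 c 1 "\<lambda>x. x ^ m * dens N x"] i(1)[OF sub(3)] c by simp
  qed
  finally show ?thesis .
qed

text \<open>First fix \<open>j\<close> so that \<open>c = (rinv ^^ j) 0\<close> satisfies
  \<open>c ^ m > 1 - \<epsilon> / 2\<close>, then take \<open>N\<close> so large that the density at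
  \<open>c\<close> is below \<open>\<epsilon> / 2\<close>.\<close>

lemma moment_tendsto_1: "moment m \<longlonglongrightarrow> 1"
proof (rule LIMSEQ_I)
  fix \<epsilon> :: real assume "\<epsilon> > 0"
  have "(\<lambda>j. 1 - (rinv ^^ j) 0) \<longlonglongrightarrow> 0"
  proof (rule tendsto_sandwich)
    show "\<forall>\<^sub>F j in sequentially. 0 \<le> 1 - (rinv ^^ j) 0"
      using rinv_funpow_bounds[of 0] by (intro always_eventually) auto
    have "1 - (rinv ^^ j) 0 \<le> 2 * inverse (real (Suc j))" for j
    proof -
      have "2 / (real j + 2) \<le> 2 * inverse (real (Suc j))"
        by (simp add: field_simps)
      then show ?thesis
        using one_minus_rinv_funpow_le[of 0 j] by simp
    qed
    then show "\<forall>\<^sub>F j in sequentially. 1 - (rinv ^^ j) 0 \<le> 2 * inverse (real (Suc j))"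
      by simp
    show "(\<lambda>j. 2 * inverse (real (Suc j))) \<longlonglongrightarrow> 0"
      by (rule tendsto_mult_right_zero[OF LIMSEQ_inverse_real_of_nat])
  qed simp
  from tendsto_power[OF tendsto_diff[OF tendsto_const[of 1] this], of m]
  have "(\<lambda>j. ((rinv ^^ j) 0) ^ m) \<longlonglongrightarrow> 1"
    by simp
  then have "\<forall>\<^sub>F j in sequentially. 1 - \<epsilon> / 2 < ((rinv ^^ j) 0) ^ m"
    using \<open>\<epsilon> > 0\<close> by (intro order_tendstoD) auto
  then obtain j where j: "1 - \<epsilon> / 2 < ((rinv ^^ j) 0) ^ m"
    by (auto dest: eventually_happens)
  define c where "c = (rinv ^^ j) 0"
  have c: "c \<in> {0..1}"
    unfolding c_def by (rule rinv_funpow_bounds) simp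
  have "(\<lambda>N. 3 ^ j * dens (N + j) 0) \<longlonglongrightarrow> 3 ^ j * 0"
    by (intro tendsto_mult_left LIMSEQ_ignore_initial_segment dens_0_tendsto_0)
  then have "\<forall>\<^sub>F N in sequentially. 3 ^ j * dens (N + j) 0 < \<epsilon> / 2"
    by (rule order_tendstoD(2)) (simp add: \<open>\<epsilon> > 0\<close>)
  then obtain N0 where N0: "\<And>N. N \<ge> N0 \<Longrightarrow> 3 ^ j * dens (N + j) 0 < \<epsilon> / 2"
    by (auto simp: eventually_sequentially)
  have "norm (moment m N - 1) < \<epsilon>" if "N \<ge> N0" for N
  proof -
    have d: "dens N c < \<epsilon> / 2"
      using dens_rinv_funpow_le[of 0 N j] N0[OF that] by (simp add: c_def)
    have "c ^ m * dens N c \<le> 1 * dens N c"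
      using c by (intro mult_right_mono power_le_one dens_nonneg) auto
    then have "1 - \<epsilon> < moment m N"
      using moment_ge[OF c, of m N] d j unfolding c_def[symmetric] by (simp add: right_diff_distrib)
    then show ?thesis
      using moment_bounds[of m N] \<open>\<epsilon> > 0\<close> by simp
  qed
  then show "\<exists>N0. \<forall>N\<ge>N0. norm (moment m N - 1) < \<epsilon>"
    by blast
qed

section \<open>The strong law and dyadic covariances\<close>

lemma Cov_sum:
  fixes X :: "'i \<Rightarrow> 'a \<Rightarrow> real" and Y :: "'j \<Rightarrow> 'a \<Rightarrow> real"
  assumes X: "\<And>i. i \<in> I \<Longrightarrow> integrable M (X i)" and Y: "\<And>j. j \<in> J \<Longrightarrow> integrable M (Y j)"
    and XY: "\<And>i j. i \<in> I \<Longrightarrow> j \<in> J \<Longrightarrow> integrable M (\<lambda>x. X i x * Y j x)"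
  shows "Cov M (\<lambda>x. \<Sum>i\<in>I. c i * X i x) (\<lambda>x. \<Sum>j\<in>J. d j * Y j x) = (\<Sum>i\<in>I. \<Sum>j\<in>J. c i * d j * Cov M (X i) (Y j))"
proof -
  have "(\<integral>x. (\<Sum>i\<in>I. c i * X i x) * (\<Sum>j\<in>J. d j * Y j x) \<partial>M)
      = (\<integral>x. (\<Sum>i\<in>I. \<Sum>j\<in>J. c i * d j * (X i x * Y j x)) \<partial>M)"
    by (simp add: sum_product mult_ac)
  also have "\<dots> = (\<Sum>i\<in>I. \<Sum>j\<in>J. c i * d j * (\<integral>x. X i x * Y j x \<partial>M))"
    using XY by (simp add: Bochner_Integration.integral_sum)
  finally have 1: "(\<integral>x. (\<Sum>i\<in>I. c i * X i x) * (\<Sum>j\<in>J. d j * Y j x) \<partial>M)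
      = (\<Sum>i\<in>I. \<Sum>j\<in>J. c i * d j * (\<integral>x. X i x * Y j x \<partial>M))" .
  have "(\<integral>x. (\<Sum>i\<in>I. c i * X i x) \<partial>M) = (\<Sum>i\<in>I. c i * (\<integral>x. X i x \<partial>M))"
    using X by (simp add: Bochner_Integration.integral_sum)
  moreover have "(\<integral>x. (\<Sum>j\<in>J. d j * Y j x) \<partial>M) = (\<Sum>j\<in>J. d j * (\<integral>x. Y j x \<partial>M))"
    using Y by (simp add: Bochner_Integration.integral_sum)
  ultimately have 2: "(\<integral>x. (\<Sum>i\<in>I. c i * X i x) \<partial>M) * (\<integral>x. (\<Sum>j\<in>J. d j * Y j x) \<partial>M)
      = (\<Sum>i\<in>I. \<Sum>j\<in>J. c i * d j * ((\<integral>x. X i x \<partial>M) * (\<integral>x. Y j x \<partial>M)))"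
    by (simp add: sum_product mult_ac)
  show ?thesis
    unfolding Cov_def 1 2 by (simp add: right_diff_distrib sum_subtractf)
qed

lemma Cov_commute: "Cov M F H = Cov M H F"
  by (simp add: Cov_def mult.commute)

text \<open>If \<open>r\<^sup>2 \<le> n < (r + 1)\<^sup>2\<close>, at most \<open>2 * r\<close>
  terms follow the first \<open>r\<^sup>2\<close>. Each is bounded by \<open>B\<close>, so they
  contribute \<open>O (1 / r)\<close> to the average.\<close>

lemma averages_tendsto_0_if_squares:
  fixes w :: "nat \<Rightarrow> real"
  assumes B: "\<And>i. \<bar>w i\<bar> \<le> B" and lim: "(\<lambda>k. (\<Sum>i<(Suc k)\<^sup>2. w i) / real ((Suc k)\<^sup>2)) \<longlonglongrightarrow> 0"
  shows "(\<lambda>n. (\<Sum>i<n. w i) / real n) \<longlonglongrightarrow> 0"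
proof (rule LIMSEQ_I)
  fix \<epsilon> :: real assume \<epsilon>: "\<epsilon> > 0"
  have B0: "0 \<le> B"
    using B[of 0] by linarith
  have "(\<lambda>k. \<bar>(\<Sum>i<(Suc k)\<^sup>2. w i) / real ((Suc k)\<^sup>2)\<bar> + 2 * B * inverse (real (Suc k))) \<longlonglongrightarrow> 0 + 2 * B * 0"
    using tendsto_rabs_zero[OF lim] by (intro tendsto_add tendsto_mult_left LIMSEQ_inverse_real_of_nat)
  then have "\<forall>\<^sub>F k in sequentially. \<bar>(\<Sum>i<(Suc k)\<^sup>2. w i) / real ((Suc k)\<^sup>2)\<bar> + 2 * B * inverse (real (Suc k)) < \<epsilon>"
    by (rule order_tendstoD(2)) (simp add: \<epsilon>)
  then obtain K where K: "\<And>k. k \<ge> K \<Longrightarrow> \<bar>(\<Sum>i<(Suc k)\<^sup>2. w i) / real ((Suc k)\<^sup>2)\<bar> + 2 * B * inverse (real (Suc k)) < \<epsilon>"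
    by (auto simp: eventually_sequentially)
  have "norm ((\<Sum>i<n. w i) / real n - 0) < \<epsilon>" if n: "n \<ge> (Suc K)\<^sup>2" for n
  proof -
    obtain k where k: "floor_sqrt n = Suc k" "k \<ge> K"
      using le_floor_sqrtI[OF n] by (cases "floor_sqrt n") auto
    define r where "r = Suc k"
    have n0: "0 < n"
      using n by (cases n) auto
    have r: "r\<^sup>2 \<le> n" "n < (Suc r)\<^sup>2" "r > 0"
      using floor_sqrt_power2_le[of n] Suc_floor_sqrt_power2_gt[of n] by (auto simp: r_def k)
    have "(\<Sum>i<n. w i) = (\<Sum>i<r\<^sup>2. w i) + (\<Sum>i=r\<^sup>2..<n. w i)"
      using r(1) by (simp add: lessThan_atLeast0 sum.atLeastLessThan_concat)
    moreover have "\<bar>\<Sum>i=r\<^sup>2..<n. w i\<bar> \<le> 2 * real r * B"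
    proof -
      have "\<bar>\<Sum>i=r\<^sup>2..<n. w i\<bar> \<le> (\<Sum>i=r\<^sup>2..<n. B)"
        using B by (intro order_trans[OF sum_abs] sum_mono)
      also have "\<dots> = real (n - r\<^sup>2) * B"
        by simp
      also have "\<dots> \<le> 2 * real r * B"
      proof (rule mult_right_mono[OF _ B0])
        have "n - r\<^sup>2 \<le> 2 * r"
          using r(2) by (simp add: power2_eq_square)
        then show "real (n - r\<^sup>2) \<le> 2 * real r"
          by linarith
      qed
      finally show ?thesis .
    qed
    ultimately have "\<bar>\<Sum>i<n. w i\<bar> \<le> \<bar>\<Sum>i<r\<^sup>2. w i\<bar> + 2 * real r * B"
      by linarith
    then have "\<bar>(\<Sum>i<n. w i) / real n\<bar> \<le> (\<bar>\<Sum>i<r\<^sup>2. w i\<bar> + 2 * real r * B) / real n"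
      by (simp add: divide_right_mono)
    also have "\<dots> \<le> (\<bar>\<Sum>i<r\<^sup>2. w i\<bar> + 2 * real r * B) / real (r\<^sup>2)"
      using r B0 n0 by (intro divide_left_mono) (auto intro!: mult_pos_pos simp del: of_nat_power)
    also have "\<dots> = \<bar>(\<Sum>i<r\<^sup>2. w i) / real (r\<^sup>2)\<bar> + 2 * B * inverse (real r)"
      using r(3) by (simp add: field_simps power2_eq_square)
    also have "\<dots> < \<epsilon>"
      using K[OF k(2)] by (simp add: r_def)
    finally show ?thesis
      by simp
  qed
  then show "\<exists>N. \<forall>n\<ge>N. norm ((\<Sum>i<n. w i) / real n - 0) < \<epsilon>"
    by blast
qed

lemma cesaro_tendsto_0:
  fixes w :: "nat \<Rightarrow> real"
  assumes "w \<longlonglongrightarrow> 0"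
  shows "(\<lambda>n. (\<Sum>i<n. w i) / real n) \<longlonglongrightarrow> 0"
proof (rule LIMSEQ_I)
  fix \<epsilon> :: real assume \<epsilon>: "\<epsilon> > 0"
  obtain N where N: "\<And>i. i \<ge> N \<Longrightarrow> \<bar>w i\<bar> < \<epsilon> / 2"
    using LIMSEQ_D[OF assms, of "\<epsilon> / 2"] \<epsilon> by auto
  define A where "A = \<bar>\<Sum>i<N. w i\<bar>"
  obtain N1 :: nat where N1: "2 * A / \<epsilon> < real N1"
    using reals_Archimedean2 by blast
  have "norm ((\<Sum>i<n. w i) / real n - 0) < \<epsilon>" if n: "n \<ge> max (Suc N) N1" for n
  proof -
    have "(\<Sum>i<n. w i) = (\<Sum>i<N. w i) + (\<Sum>i=N..<n. w i)"
      using n by (simp add: lessThan_atLeast0 sum.atLeastLessThan_concat)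
    moreover have "\<bar>\<Sum>i=N..<n. w i\<bar> \<le> (\<Sum>i=N..<n. \<epsilon> / 2)"
      using N by (intro order_trans[OF sum_abs] sum_mono) (auto intro: less_imp_le)
    moreover have "(\<Sum>i=N..<n. \<epsilon> / 2) \<le> real n * (\<epsilon> / 2)"
      using \<epsilon> by simp
    moreover have "A < real n * (\<epsilon> / 2)"
    proof -
      have "2 * A / \<epsilon> < real n"
        using N1 n by linarith
      then show ?thesis
        using \<epsilon> by (simp add: field_simps)
    qed
    ultimately have "\<bar>\<Sum>i<n. w i\<bar> < real n * \<epsilon>"
      unfolding A_def by linarith
    then show ?thesis
      using n by (simp add: field_simps)
  qed
  then show "\<exists>N. \<forall>n\<ge>N. norm ((\<Sum>i<n. w i) / real n - 0) < \<epsilon>"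
    by blast
qed

lemma (in prob_space) Cov_bounded:
  assumes "random_variable borel F" "random_variable borel H"
    and "\<And>x. x \<in> space M \<Longrightarrow> \<bar>F x\<bar> \<le> B" "\<And>x. x \<in> space M \<Longrightarrow> \<bar>H x\<bar> \<le> B"
  shows "integrable M F" "integrable M (\<lambda>x. F x * H x)"
    "(\<integral>x. (F x - expectation F) * (H x - expectation H) \<partial>M) = Cov M F H"
    "\<bar>Cov M F H\<bar> \<le> 2 * B\<^sup>2"
proof -
  have F: "integrable M F"
    using assms by (intro integrable_const_bound[where B = B]) auto
  have H: "integrable M H"
    using assms by (intro integrable_const_bound[where B = B]) auto
  have b: "\<bar>F x * H x\<bar> \<le> B * B" if "x \<in> space M" for x
    unfolding abs_mult using assms(3,4)[OF that] by (intro mult_mono) auto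
  have FH: "integrable M (\<lambda>x. F x * H x)"
    using assms b by (intro integrable_const_bound[where B = "B * B"]) auto
  show "integrable M F" "integrable M (\<lambda>x. F x * H x)"
    by fact+
  have "(\<integral>x. (F x - expectation F) * (H x - expectation H) \<partial>M)
      = (\<integral>x. F x * H x - expectation H * F x - expectation F * H x + expectation F * expectation H \<partial>M)"
    by (simp add: algebra_simps)
  also have "\<dots> = Cov M F H"
    using F H FH by (simp add: Cov_def prob_space)
  finally show "(\<integral>x. (F x - expectation F) * (H x - expectation H) \<partial>M) = Cov M F H" .
  have "\<bar>expectation (\<lambda>x. F x * H x)\<bar> \<le> B * B"
    using integral_abs_bound[of M "\<lambda>x. F x * H x"] integral_le_const[of "\<lambda>x. \<bar>F x * H x\<bar>" "B * B"] FH b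
    by (auto intro!: order_trans[OF integral_abs_bound])
  moreover have "\<bar>expectation F\<bar> \<le> B"
    using integral_le_const[of "\<lambda>x. \<bar>F x\<bar>" B] F assms(3) by (auto intro!: order_trans[OF integral_abs_bound])
  moreover have "\<bar>expectation H\<bar> \<le> B"
    using integral_le_const[of "\<lambda>x. \<bar>H x\<bar>" B] H assms(4) by (auto intro!: order_trans[OF integral_abs_bound])
  moreover have "\<bar>expectation F * expectation H\<bar> \<le> B * B"
    unfolding abs_mult using calculation(2,3) by (intro mult_mono) auto
  ultimately show "\<bar>Cov M F H\<bar> \<le> 2 * B\<^sup>2"
    unfolding Cov_def power2_eq_square by linarith
qed

text \<open>The variance of the average over the first \<open>r\<^sup>2\<close> terms is at most
  \<open>C / r\<^sup>2\<close>, which is summable over \<open>r\<close>. So the squared centred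
  averages along the squares have an almost surely finite sum and tend to 0; boundedness fills the
  gaps, and Cesaro averaging handles the means.\<close>

lemma (in prob_space) strong_law_linear_covariance:
  fixes Z :: "nat \<Rightarrow> 'a \<Rightarrow> real"
  assumes Z [measurable]: "\<And>i. random_variable borel (Z i)" and B: "\<And>i x. x \<in> space M \<Longrightarrow> \<bar>Z i x\<bar> \<le> B"
    and C: "\<And>n. (\<Sum>i<n. \<Sum>j<n. \<bar>Cov M (Z i) (Z j)\<bar>) \<le> C * real n"
    and mean: "(\<lambda>i. expectation (Z i)) \<longlonglongrightarrow> c"
  shows "AE x in M. (\<lambda>n. (\<Sum>i<n. Z i x) / real n) \<longlonglongrightarrow> c"
proof -
  define W where "W i x = Z i x - expectation (Z i)" for i x
  have W [measurable]: "random_variable borel (W i)" for i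
    unfolding W_def by measurable
  have eB: "\<bar>expectation (Z i)\<bar> \<le> B" for i
    using Cov_bounded(1)[of "Z i" "Z i" B] B integral_le_const[of "\<lambda>x. \<bar>Z i x\<bar>" B]
    by (auto intro!: order_trans[OF integral_abs_bound])
  have WB: "\<bar>W i x\<bar> \<le> 2 * B" if "x \<in> space M" for i x
    using B[OF that, of i] eB[of i] by (simp add: W_def)
  have WW: "integrable M (\<lambda>x. W i x * W j x)" for i j
    by (rule Cov_bounded(2)[of _ _ "2 * B"]) (auto intro: WB)
  define Y where "Y k x = ((\<Sum>i<(Suc k)\<^sup>2. W i x) / real ((Suc k)\<^sup>2))\<^sup>2" for k x
  have Y [measurable]: "random_variable borel (Y k)" for k
    unfolding Y_def by measurable
  have sq: "(\<Sum>i<n. W i x)\<^sup>2 = (\<Sum>i<n. \<Sum>j<n. W i x * W j x)" for n x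
    by (simp add: power2_eq_square sum_product)
  have EW: "expectation (\<lambda>x. (\<Sum>i<n. W i x)\<^sup>2) \<le> C * real n" for n
  proof -
    have "expectation (\<lambda>x. (\<Sum>i<n. W i x)\<^sup>2) = (\<Sum>i<n. \<Sum>j<n. expectation (\<lambda>x. W i x * W j x))"
      unfolding sq using WW by (simp add: Bochner_Integration.integral_sum)
    also have "\<dots> = (\<Sum>i<n. \<Sum>j<n. Cov M (Z i) (Z j))"
      unfolding W_def by (intro sum.cong refl Cov_bounded(3)[of _ _ B]) (auto intro: B)
    also have "\<dots> \<le> (\<Sum>i<n. \<Sum>j<n. \<bar>Cov M (Z i) (Z j)\<bar>)"
      by (intro sum_mono) auto
    finally show ?thesis
      using C[of n] by linarith
  qed
  have Yint: "integrable M (Y k)" for k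
    unfolding Y_def power_divide sq using WW by simp
  have EY: "expectation (Y k) \<le> C * inverse ((real (Suc k))\<^sup>2)" for k
  proof -
    have "expectation (Y k) = expectation (\<lambda>x. (\<Sum>i<(Suc k)\<^sup>2. W i x)\<^sup>2) / (real ((Suc k)\<^sup>2))\<^sup>2"
      unfolding Y_def power_divide by simp
    also have "\<dots> \<le> C * real ((Suc k)\<^sup>2) / (real ((Suc k)\<^sup>2))\<^sup>2"
      by (intro divide_right_mono EW) simp
    also have "\<dots> = C * inverse ((real (Suc k))\<^sup>2)"
    proof -
      have "real ((Suc k)\<^sup>2) = (real (Suc k))\<^sup>2" "real (Suc k) \<noteq> 0"
        by (simp_all add: of_nat_power del: of_nat_Suc)
      then show ?thesis
        by (simp only: power2_eq_square) (simp add: field_simps del: of_nat_Suc of_nat_mult)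
    qed
    finally show ?thesis .
  qed
  have "summable (\<lambda>k. inverse ((real (Suc k))\<^sup>2))"
    using inverse_power_summable[of 2, where 'a = real] by (subst summable_Suc_iff) simp
  then have sC: "summable (\<lambda>k. C * inverse ((real (Suc k))\<^sup>2))"
    by (rule summable_mult)
  have EY0: "0 \<le> expectation (Y k)" for k
    by (rule Bochner_Integration.integral_nonneg) (simp add: Y_def)
  have sEY: "summable (\<lambda>k. expectation (Y k))"
    by (rule summable_comparison_test'[OF sC, of 0]) (use EY EY0 in auto)
  have "(\<integral>\<^sup>+x. (\<Sum>k. ennreal (Y k x)) \<partial>M) = (\<Sum>k. \<integral>\<^sup>+x. ennreal (Y k x) \<partial>M)"
    by (rule nn_integral_suminf) simp
  also have "\<dots> = (\<Sum>k. ennreal (expectation (Y k)))"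
    by (intro suminf_cong nn_integral_eq_integral Yint) (simp add: Y_def)
  also have "\<dots> = ennreal (\<Sum>k. expectation (Y k))"
    using EY0 sEY by (rule suminf_ennreal2)
  finally have "(\<integral>\<^sup>+x. (\<Sum>k. ennreal (Y k x)) \<partial>M) \<noteq> \<infinity>"
    by simp
  then have "AE x in M. (\<Sum>k. ennreal (Y k x)) \<noteq> \<infinity>"
    by (intro nn_integral_PInf_AE) auto
  then show ?thesis
  proof (rule AE_mp, intro AE_I2 impI)
    fix x assume x: "x \<in> space M" and "(\<Sum>k. ennreal (Y k x)) \<noteq> \<infinity>"
    then have "summable (\<lambda>k. Y k x)"
      by (intro summable_suminf_not_top) (auto simp: Y_def)
    then have "(\<lambda>k. Y k x) \<longlonglongrightarrow> 0"
      by (rule summable_LIMSEQ_zero)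
    then have "(\<lambda>k. sqrt (Y k x)) \<longlonglongrightarrow> 0"
      using tendsto_real_sqrt by fastforce
    then have "(\<lambda>k. (\<Sum>i<(Suc k)\<^sup>2. W i x) / real ((Suc k)\<^sup>2)) \<longlonglongrightarrow> 0"
      unfolding Y_def real_sqrt_abs by (rule tendsto_rabs_zero_cancel)
    then have 1: "(\<lambda>n. (\<Sum>i<n. W i x) / real n) \<longlonglongrightarrow> 0"
      by (rule averages_tendsto_0_if_squares[OF WB[OF x]])
    have "(\<lambda>i. expectation (Z i) - c) \<longlonglongrightarrow> 0"
      using mean by (simp add: LIM_zero)
    then have 2: "(\<lambda>n. (\<Sum>i<n. expectation (Z i) - c) / real n) \<longlonglongrightarrow> 0"
      by (rule cesaro_tendsto_0)
    have "(\<lambda>n. (\<Sum>i<n. W i x) / real n + (\<Sum>i<n. expectation (Z i) - c) / real n + c) \<longlonglongrightarrow> 0 + 0 + c"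
      by (intro tendsto_add 1 2 tendsto_const)
    \<comment> \<open>At \<open>n = 0\<close> the left side is \<open>c\<close> and the right side
      is 0, so the equality is claimed only eventually.\<close>
    moreover have "\<forall>\<^sub>F n in sequentially. (\<Sum>i<n. W i x) / real n + (\<Sum>i<n. expectation (Z i) - c) / real n + c = (\<Sum>i<n. Z i x) / real n"
      using eventually_gt_at_top[of 0]
      by eventually_elim (simp add: W_def sum_subtractf field_simps)
    ultimately show "(\<lambda>n. (\<Sum>i<n. Z i x) / real n) \<longlonglongrightarrow> c"
      by (simp add: tendsto_cong)
  qed
qed

section \<open>Summed covariances along dyadic times\<close>

text \<open>With truncated subtraction the exponent is the distance between \<open>i\<close> and
  \<open>j\<close>. The geometric series over \<open>j \<le> i\<close> contributes at most 2, the
  one over \<open>j > i\<close> at most 1.\<close>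

lemma sum_half_power_le:
  "(\<Sum>j<n. (1 / 2 :: real) ^ ((i - j) + (j - i))) \<le> 3"
proof -
  have 1: "(\<Sum>j<n. (1 / 2 :: real) ^ ((i - j) + (j - i))) \<le> 2 * (1 / 2) ^ (Suc i - n)" if "n \<le> Suc i" for n
    using that
  proof (induction n)
    case (Suc n)
    then have "Suc i - n = Suc (i - n)" "Suc i - Suc n = i - n" "n - i = 0"
      by auto
    with Suc show ?case by simp
  qed simp
  have 2: "(\<Sum>j<Suc i + d. (1 / 2 :: real) ^ ((i - j) + (j - i))) \<le> 3 - (1 / 2) ^ d" for d
  proof (induction d)
    case 0
    then show ?case using 1[of "Suc i"] by simp
  next
    case (Suc d)
    have "(\<Sum>j<Suc i + Suc d. (1 / 2 :: real) ^ ((i - j) + (j - i)))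
        = (\<Sum>j<Suc i + d. (1 / 2) ^ ((i - j) + (j - i))) + (1 / 2) ^ Suc d"
      by simp
    with Suc show ?case by simp
  qed
  have "(\<Sum>j<n. (1 / 2 :: real) ^ ((i - j) + (j - i))) \<le> (\<Sum>j<Suc i + n. (1 / 2) ^ ((i - j) + (j - i)))"
    by (intro sum_mono2) auto
  also have "\<dots> \<le> 3"
    using 2[of n] by (smt (verit) zero_le_power zero_le_divide_1_iff)
  finally show ?thesis .
qed

definition poly_upto :: "(nat \<Rightarrow> real) \<Rightarrow> nat \<Rightarrow> real \<Rightarrow> real" where
  "poly_upto a d x = (\<Sum>m<d. a m * x ^ m)"

lemma borel_measurable_power_g1: "(\<lambda>x. ((g1 ^^ N) x) ^ m) \<in> borel_measurable leb_I"
  by (intro borel_measurable_leb_I) simp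

lemma power_g1_bounded: "x \<in> space leb_I \<Longrightarrow> \<bar>((g1 ^^ N) x) ^ m\<bar> \<le> 1"
  using g1_funpow_mem[of x N] by (intro power_bounded_1) simp

lemma Cov_poly_le:
  "\<exists>A\<ge>0. \<forall>N k. \<bar>Cov leb_I (\<lambda>x. poly_upto a d ((g1 ^^ N) x)) (\<lambda>x. poly_upto a d ((g1 ^^ (N + k)) x))\<bar>
      \<le> A * ((1 + real N) / (real k + 2))"
proof -
  interpret prob_space leb_I
    by (rule prob_space_leb_I)
  define A where "A = (\<Sum>m<d. \<Sum>l<d. \<bar>a m * a l\<bar> * ((1 + real l) * 2))"
  have "\<bar>Cov leb_I (\<lambda>x. poly_upto a d ((g1 ^^ N) x)) (\<lambda>x. poly_upto a d ((g1 ^^ (N + k)) x))\<bar>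
      \<le> A * ((1 + real N) / (real k + 2))" for N k
  proof -
    have "Cov leb_I (\<lambda>x. poly_upto a d ((g1 ^^ N) x)) (\<lambda>x. poly_upto a d ((g1 ^^ (N + k)) x))
        = (\<Sum>m<d. \<Sum>l<d. a m * a l * Cov leb_I (\<lambda>x. ((g1 ^^ N) x) ^ m) (\<lambda>x. ((g1 ^^ (N + k)) x) ^ l))"
      unfolding poly_upto_def
      by (intro Cov_sum
          Cov_bounded(1)[OF borel_measurable_power_g1 borel_measurable_power_g1 power_g1_bounded power_g1_bounded]
          Cov_bounded(2)[OF borel_measurable_power_g1 borel_measurable_power_g1 power_g1_bounded power_g1_bounded])
    also have "\<bar>\<dots>\<bar> \<le> (\<Sum>m<d. \<Sum>l<d. \<bar>a m * a l\<bar> * ((1 + real l) * (2 * (1 + real N) / (real k + 2))))"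
      by (intro order_trans[OF sum_abs] sum_mono) (subst abs_mult, intro mult_left_mono Cov_power_le abs_ge_zero)
    also have "\<dots> = A * ((1 + real N) / (real k + 2))"
      unfolding A_def sum_distrib_right by (intro sum.cong) (auto simp: algebra_simps add_divide_distrib)
    finally show ?thesis .
  qed
  moreover have "0 \<le> A"
    unfolding A_def by (intro sum_nonneg) auto
  ultimately show ?thesis
    by blast
qed

text \<open>With \<open>N = 2 ^ i\<close> and \<open>N + k = 2 ^ j\<close> the ratio
  \<open>(1 + N) / (k + 2)\<close> is at most \<open>4 * (1 / 2) ^ (j - i)\<close>, so each row of
  the double sum is dominated by a convergent geometric series. The outcome is linear in
  \<open>n\<close>.\<close>

lemma Cov_dyadic_sum_le:
  "\<exists>C\<ge>0. \<forall>n. (\<Sum>i<n. \<Sum>j<n. \<bar>Cov leb_I (\<lambda>x. poly_upto a d ((g1 ^^ (2 ^ i)) x)) (\<lambda>x. poly_upto a d ((g1 ^^ (2 ^ j)) x))\<bar>) \<le> C * real n"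
proof -
  interpret prob_space leb_I
    by (rule prob_space_leb_I)
  let ?F = "\<lambda>N x. poly_upto a d ((g1 ^^ N) x)"
  obtain A where A: "A \<ge> 0" "\<And>N k. \<bar>Cov leb_I (?F N) (?F (N + k))\<bar> \<le> A * ((1 + real N) / (real k + 2))"
    using Cov_poly_le[of a d] by blast
  define B where "B = (\<Sum>m<d. \<bar>a m\<bar>)"
  \<comment> \<open>\<open>4 * A\<close> serves the off-diagonal terms, \<open>2 * B\<^sup>2\<close>
    the variances on the diagonal.\<close>
  define D where "D = 4 * A + 2 * B\<^sup>2"
  have FB: "\<bar>?F N x\<bar> \<le> B" if "x \<in> space leb_I" for N x
    unfolding poly_upto_def B_def
    by (intro order_trans[OF sum_abs] sum_mono)
      (use mult_left_mono[OF power_g1_bounded[OF that]] in \<open>auto simp: abs_mult\<close>)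
  have FM: "?F N \<in> borel_measurable leb_I" for N
    unfolding poly_upto_def using borel_measurable_power_g1 by (intro borel_measurable_sum borel_measurable_times) auto
  have lt: "\<bar>Cov leb_I (?F (2 ^ i)) (?F (2 ^ j))\<bar> \<le> 4 * A * (1 / 2) ^ (j - i)" if "i < j" for i j :: nat
  proof -
    define k :: nat where "k = 2 ^ j - 2 ^ i"
    have le: "(2::nat) ^ i \<le> 2 ^ j"
      using that by (intro power_increasing) auto
    have "(2::real) ^ j = 2 ^ i * 2 ^ (j - i)"
      using that by (simp flip: power_add)
    \<comment> \<open>As \<open>j - i\<close> is at least 1, subtracting 1 from
      \<open>2 ^ (j - i)\<close> costs at most a factor 2.\<close>
    moreover have "(2::real) ^ 1 \<le> 2 ^ (j - i)"
      using that by (intro power_increasing) auto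
    ultimately have k: "real k = 2 ^ i * (2 ^ (j - i) - 1)" "2 ^ (j - i) \<le> 2 * (2 ^ (j - i) - 1 :: real)"
      using le by (auto simp: k_def of_nat_diff algebra_simps)
    have "(1 + real (2 ^ i)) / (real k + 2) \<le> 4 * (1 / 2) ^ (j - i)"
    proof -
      have "(1 + 2 ^ i) * 2 ^ (j - i) \<le> (2 * 2 ^ i) * (2 * (2 ^ (j - i) - 1 :: real))"
        using k(2) by (intro mult_mono) auto
      also have "\<dots> \<le> 4 * (real k + 2)"
        unfolding k(1) by (simp add: algebra_simps)
      finally show ?thesis
        by (simp add: field_simps)
    qed
    then have "A * ((1 + real (2 ^ i)) / (real k + 2)) \<le> A * (4 * (1 / 2) ^ (j - i))"
      using A(1) by (rule mult_left_mono)
    moreover have "2 ^ i + k = 2 ^ j"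
      using le by (simp add: k_def)
    ultimately show ?thesis
      using A(2)[of "2 ^ i" k] by (simp add: mult_ac)
  qed
  have D: "\<bar>Cov leb_I (?F (2 ^ i)) (?F (2 ^ j))\<bar> \<le> D * (1 / 2) ^ ((i - j) + (j - i))" for i j
  proof -
    have AD: "4 * A * (1 / 2) ^ e \<le> D * (1 / 2) ^ e" for e
      by (intro mult_right_mono) (auto simp: D_def)
    consider "i < j" | "j < i" | "i = j"
      by linarith
    then show ?thesis
    proof cases
      case 1
      then show ?thesis
        using order_trans[OF lt[of i j] AD[of "j - i"]] by simp
    next
      case 2
      then show ?thesis
        using order_trans[OF lt[of j i] AD[of "i - j"]] Cov_commute[of leb_I "?F (2 ^ i)"] by simp
    next
      case 3
      then show ?thesis
        using Cov_bounded(4)[OF FM FM FB FB, of "2 ^ i" "2 ^ i"] A(1) by (simp add: D_def)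
    qed
  qed
  have D0: "0 \<le> D"
    using A(1) by (simp add: D_def)
  have "(\<Sum>i<n. \<Sum>j<n. \<bar>Cov leb_I (?F (2 ^ i)) (?F (2 ^ j))\<bar>) \<le> 3 * D * real n" for n
  proof -
    have "(\<Sum>i<n. \<Sum>j<n. \<bar>Cov leb_I (?F (2 ^ i)) (?F (2 ^ j))\<bar>) \<le> (\<Sum>i<n. \<Sum>j<n. D * (1 / 2) ^ ((i - j) + (j - i)))"
      by (intro sum_mono D)
    also have "\<dots> = (\<Sum>i<n. D * (\<Sum>j<n. (1 / 2) ^ ((i - j) + (j - i))))"
      by (simp add: sum_distrib_left)
    also have "\<dots> \<le> (\<Sum>i<n. D * 3)"
      by (intro sum_mono mult_left_mono sum_half_power_le D0)
    finally show ?thesis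
      by (simp add: mult_ac)
  qed
  then show ?thesis
    using D0 by (intro exI[of _ "3 * D"]) auto
qed

section \<open>Weak-star convergence\<close>

text \<open>The measure is the image under \<open>y\<close> of the point measure with weights
  \<open>c\<close> on \<open>J\<close>; coinciding values of \<open>y\<close> are gathered by its
  fibres.\<close>

lemma integral_dirac_sum:
  fixes f :: "real \<Rightarrow> real"
  assumes J: "finite J" and c: "\<And>i. i \<in> J \<Longrightarrow> 0 \<le> c i" and y: "\<And>i. i \<in> J \<Longrightarrow> y i \<in> {-1..1}"
    and f: "f \<in> mspace C_I"
  shows "(\<integral>x. f x \<partial>dirac_sum J c y) = (\<Sum>i\<in>J. c i * f (y i))"
proof -
  let ?M = "point_measure J (\<lambda>i. ennreal (c i))"
  have y': "y \<in> measurable ?M borel_I"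
    using y by (auto simp: space_restrict_space)
  have eq: "dirac_sum J c y = distr ?M borel_I y"
  proof (rule measure_eqI)
    fix A assume "A \<in> sets (dirac_sum J c y)"
    then have A: "A \<in> sets borel_I"
      by simp
    have "emeasure (distr ?M borel_I y) A = (\<Sum>i\<in>y -` A \<inter> J. ennreal (c i))"
      using A J y' by (simp add: emeasure_distr emeasure_point_measure_finite space_point_measure)
    also have "\<dots> = (\<Sum>i\<in>J. ennreal (c i) * indicator A (y i))"
      using J by (intro sum.mono_neutral_cong_left) (auto simp: indicator_def)
    finally show "emeasure (dirac_sum J c y) A = emeasure (distr ?M borel_I y) A"
      using A by (simp add: emeasure_dirac_sum)
  qed simp
  have "f \<in> borel_measurable borel_I"
    using f by (intro borel_measurable_continuous_on_restrict) (simp add: mem_C_I)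
  then have "(\<integral>x. f x \<partial>dirac_sum J c y) = (\<integral>i. f (y i) \<partial>?M)"
    unfolding eq by (rule integral_distr[OF y'])
  also have "\<dots> = (\<Sum>i\<in>J. c i * f (y i))"
    using J c by (simp add: lebesgue_integral_point_measure_finite)
  finally show ?thesis .
qed

lemma integral_mu_dyad:
  assumes "f \<in> mspace C_I" "x \<in> {-1..1}"
  shows "(\<integral>t. f t \<partial>mu_dyad n x) = (\<Sum>k<n. f ((g1 ^^ (2 ^ k)) x)) / real n"
  unfolding mu_dyad_def using g1_funpow_mem[OF assms(2)]
  by (subst integral_dirac_sum[OF _ _ _ assms(1)]) (auto simp: sum_divide_distrib)

lemma integral_half_half:
  assumes "f \<in> mspace C_I"
  shows "(\<integral>t. f t \<partial>half_half) = (f (-1) + f 1) / 2"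
  unfolding half_half_def
  by (subst integral_dirac_sum[OF _ _ _ assms]) auto

lemma prob_space_half_half: "prob_space half_half"
proof
  have "{-1..1} \<in> sets borel_I"
    using sets.top[of borel_I] by (simp add: space_restrict_space)
  then have "emeasure half_half (space half_half) = (\<Sum>p\<in>{-1, 1}. ennreal (1 / 2) * indicator {-1..1::real} p)"
    unfolding half_half_def space_dirac_sum by (rule emeasure_dirac_sum)
  also have "\<dots> = (\<Sum>p\<in>{-1, 1::real}. ennreal (1 / 2))"
    by (rule sum.cong) auto
  also have "\<dots> = ennreal (\<Sum>p\<in>{-1, 1::real}. 1 / 2)"
    by (rule sum_ennreal) simp
  also have "(\<Sum>p\<in>{-1, 1::real}. 1 / 2) = (1::real)"
    by simp
  finally show "emeasure half_half (space half_half) = 1"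
    by simp
qed

section \<open>A countable dense set of polynomials\<close>

lemma poly_approximation:
  assumes "continuous_on {-1..1} f" "0 < e"
  obtains a d where "\<And>x. x \<in> {-1..1} \<Longrightarrow> \<bar>f x - poly_upto a d x\<bar> < e"
proof -
  obtain g where g: "real_polynomial_function g" "\<And>x. x \<in> {-1..1} \<Longrightarrow> \<bar>f x - g x\<bar> < e"
    using Stone_Weierstrass_real_polynomial_function[OF compact_Icc assms] by blast
  then obtain a n where "g = (\<lambda>x. \<Sum>i\<le>n. a i * x ^ i)"
    by (auto simp: real_polynomial_function_iff_sum)
  then have "\<bar>f x - poly_upto a (Suc n) x\<bar> < e" if "x \<in> {-1..1}" for x
    using g(2)[OF that] by (simp add: poly_upto_def lessThan_Suc_atMost)
  then show thesis
    using that by blast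
qed

text \<open>Lists of rational coefficients make the range countable, and the restriction makes the
  function extensional, as points of \<open>C_I\<close> must be.\<close>

definition rat_poly :: "rat list \<Rightarrow> real \<Rightarrow> real" where
  "rat_poly cs = restrict (poly_upto (\<lambda>i. of_rat (cs ! i)) (length cs)) {-1..1}"

lemma continuous_on_poly_upto: "continuous_on S (poly_upto a d)"
  unfolding poly_upto_def by (intro continuous_intros)

lemma rat_poly_mem_C_I: "rat_poly cs \<in> mspace C_I"
proof -
  have "continuous_on {-1..1} (rat_poly cs)"
    by (rule continuous_on_eq[OF continuous_on_poly_upto]) (simp add: rat_poly_def)
  then show ?thesis
    by (simp add: mem_C_I rat_poly_def)
qed

lemma rat_poly_approximation:
  assumes "continuous_on {-1..1} f" "0 < e"
  obtains cs where "\<And>x. x \<in> {-1..1} \<Longrightarrow> \<bar>f x - rat_poly cs x\<bar> < e"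
proof -
  obtain a d where a: "\<And>x. x \<in> {-1..1} \<Longrightarrow> \<bar>f x - poly_upto a d x\<bar> < e / 2"
    using poly_approximation[OF assms(1), of "e / 2"] assms(2) by auto
  \<comment> \<open>The \<open>d\<close> coefficient errors add up to at most \<open>e / 2\<close>
    on [-1,1]; \<open>Suc d\<close> keeps the denominator positive when
    \<open>d = 0\<close>.\<close>
  have "\<exists>r. \<bar>a i - of_rat r\<bar> < e / (2 * real (Suc d))" for i
  proof -
    have "a i - e / (2 * real (Suc d)) < a i"
      using assms(2) by simp
    then obtain r where "a i - e / (2 * real (Suc d)) < of_rat r" "of_rat r < a i"
      using of_rat_dense by blast
    then have "\<bar>a i - of_rat r\<bar> < e / (2 * real (Suc d))"
      by linarith
    then show ?thesis ..
  qed
  then obtain r where r: "\<And>i. \<bar>a i - of_rat (r i)\<bar> < e / (2 * real (Suc d))"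
    by metis
  have "\<bar>f x - rat_poly (map r [0..<d]) x\<bar> < e" if x: "x \<in> {-1..1}" for x
  proof -
    have "rat_poly (map r [0..<d]) x = (\<Sum>m<d. of_rat (r m) * x ^ m)"
      using x by (simp add: rat_poly_def poly_upto_def)
    then have "poly_upto a d x - rat_poly (map r [0..<d]) x = (\<Sum>m<d. (a m - of_rat (r m)) * x ^ m)"
      by (simp add: poly_upto_def sum_subtractf left_diff_distrib)
    also have "\<bar>\<dots>\<bar> \<le> (\<Sum>m<d. e / (2 * real (Suc d)))"
    proof (intro order_trans[OF sum_abs] sum_mono)
      fix m
      have "\<bar>a m - of_rat (r m)\<bar> * \<bar>x ^ m\<bar> \<le> e / (2 * real (Suc d)) * 1"
        using r[of m] power_bounded_1[OF x, of m] assms(2) by (intro mult_mono) auto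
      then show "\<bar>(a m - of_rat (r m)) * x ^ m\<bar> \<le> e / (2 * real (Suc d))"
        by (simp add: abs_mult)
    qed
    also have "\<dots> \<le> e / 2"
      using assms(2) by (simp add: field_simps)
    finally show ?thesis
      using a[OF x] by linarith
  qed
  then show thesis
    using that by blast
qed

lemma closure_of_range_rat_poly: "mtopology_of C_I closure_of range rat_poly = mspace C_I"
proof -
  interpret Metric_space "mspace C_I" "mdist C_I"
    by (rule Metric_space_mspace_mdist)
  have "\<exists>g\<in>range rat_poly. g \<in> mcball f r" if f: "f \<in> mspace C_I" and r: "0 < r" for f r
  proof -
    obtain cs where cs: "\<And>x. x \<in> {-1..1} \<Longrightarrow> \<bar>f x - rat_poly cs x\<bar> < r"
      using rat_poly_approximation[of f r] f r by (auto simp: mem_C_I)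
    have "mdist C_I f (rat_poly cs) \<le> r"
      unfolding C_I_def using r cs by (intro mdist_cfunspace_le) (auto simp: dist_real_def intro: less_imp_le)
    then have "rat_poly cs \<in> mcball f r"
      using f rat_poly_mem_C_I by simp
    then show ?thesis
      by blast
  qed
  then show ?thesis
    unfolding mtopology_of_def metric_closure_of_alt by auto
qed

text \<open>Orbits stay in [-1,1], where the restriction agrees with the polynomial.\<close>

lemma Cov_rat_poly:
  "Cov leb_I (rat_poly cs \<circ> (g1 ^^ N)) (rat_poly cs \<circ> (g1 ^^ N'))
    = Cov leb_I (\<lambda>x. poly_upto (\<lambda>i. of_rat (cs ! i)) (length cs) ((g1 ^^ N) x))
        (\<lambda>x. poly_upto (\<lambda>i. of_rat (cs ! i)) (length cs) ((g1 ^^ N') x))"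
proof -
  have "(rat_poly cs \<circ> (g1 ^^ N)) x = poly_upto (\<lambda>i. of_rat (cs ! i)) (length cs) ((g1 ^^ N) x)"
    if "x \<in> space leb_I" for x N
    using g1_funpow_mem[of x N] that by (simp add: rat_poly_def)
  then show ?thesis
    unfolding Cov_def
    by (intro arg_cong2[where f = "(-)"] arg_cong2[where f = "(*)"] Bochner_Integration.integral_cong) auto
qed

section \<open>Almost sure convergence\<close>

text \<open>The limit is the integral of \<open>x ^ m\<close> against \<open>half_half\<close>: the
  means vanish for odd \<open>m\<close> and tend to 1 for even \<open>m\<close>. The monomial is a
  \<open>poly_upto\<close> with one nonzero coefficient, so the dyadic covariance bound
  applies.\<close>

lemma AE_power_averages:
  "AE x in leb_I. (\<lambda>n. (\<Sum>k<n. ((g1 ^^ (2 ^ k)) x) ^ m) / real n) \<longlonglongrightarrow> ((-1) ^ m + 1) / 2"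
proof -
  interpret prob_space leb_I
    by (rule prob_space_leb_I)
  have p: "poly_upto (\<lambda>i. if i = m then 1 else 0) (Suc m) = (\<lambda>x. x ^ m)"
    by (simp add: poly_upto_def fun_eq_iff if_distrib[of "\<lambda>t. t * _"] cong: if_cong)
  obtain C where C: "\<And>n. (\<Sum>i<n. \<Sum>j<n. \<bar>Cov leb_I (\<lambda>x. ((g1 ^^ (2 ^ i)) x) ^ m) (\<lambda>x. ((g1 ^^ (2 ^ j)) x) ^ m)\<bar>) \<le> C * real n"
    using Cov_dyadic_sum_le[of "\<lambda>i. if i = m then 1 else 0" "Suc m"] unfolding p by blast
  have pw: "filterlim (\<lambda>i. 2 ^ i :: nat) sequentially sequentially"
    by (rule filterlim_subseq) (simp add: strict_mono_def)
  have mean: "(\<lambda>i. expectation (\<lambda>x. ((g1 ^^ (2 ^ i)) x) ^ m)) \<longlonglongrightarrow> ((-1) ^ m + 1) / 2"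
  proof (cases "even m")
    case True
    then show ?thesis
      using filterlim_compose[OF moment_tendsto_1[of m] pw] by (simp add: expectation_power_eq)
  next
    case False
    then show ?thesis
      by (simp add: expectation_power_eq)
  qed
  show ?thesis
    by (rule strong_law_linear_covariance[OF borel_measurable_power_g1 power_g1_bounded C mean])
qed

text \<open>Linearity passes from powers to polynomials, and uniform approximation with three errors
  of size \<open>e / 3\<close> passes to continuous functions.\<close>

lemma weak_star_tendsto_if_powers:
  assumes x: "x \<in> {-1..1}"
    and pow: "\<And>m. (\<lambda>n. (\<Sum>k<n. ((g1 ^^ (2 ^ k)) x) ^ m) / real n) \<longlonglongrightarrow> ((-1) ^ m + 1) / 2"
  shows "weak_star_tendsto (\<lambda>n. mu_dyad n x) half_half"
  unfolding weak_star_tendsto_def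
proof
  fix f assume f: "f \<in> mspace C_I"
  define avg where "avg h n = (\<Sum>k<n. h ((g1 ^^ (2 ^ k)) x)) / real n" for h :: "real \<Rightarrow> real" and n
  define lim2 where "lim2 h = (h (-1) + h 1) / 2" for h :: "real \<Rightarrow> real"
  have poly: "avg (poly_upto a d) \<longlonglongrightarrow> lim2 (poly_upto a d)" for a d
  proof -
    have "(\<lambda>n. \<Sum>m<d. a m * ((\<Sum>k<n. ((g1 ^^ (2 ^ k)) x) ^ m) / real n)) \<longlonglongrightarrow> (\<Sum>m<d. a m * (((-1) ^ m + 1) / 2))"
      by (intro tendsto_sum tendsto_mult_left pow)
    moreover have "(\<Sum>m<d. a m * ((\<Sum>k<n. ((g1 ^^ (2 ^ k)) x) ^ m) / real n)) = avg (poly_upto a d) n" for n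
      unfolding avg_def poly_upto_def
      by (subst sum.swap) (simp add: sum_distrib_left sum_divide_distrib)
    moreover have "(\<Sum>m<d. a m * (((-1) ^ m + 1) / 2)) = lim2 (poly_upto a d)"
      unfolding lim2_def poly_upto_def
      by (simp add: sum.distrib[symmetric] sum_divide_distrib algebra_simps add_divide_distrib)
    ultimately show ?thesis
      by simp
  qed
  have "avg f \<longlonglongrightarrow> lim2 f"
  proof (rule LIMSEQ_I)
    fix e :: real assume e: "0 < e"
    obtain a d where a: "\<And>y. y \<in> {-1..1} \<Longrightarrow> \<bar>f y - poly_upto a d y\<bar> < e / 3"
      using poly_approximation[of f "e / 3"] f e by (auto simp: mem_C_I)
    have 1: "\<bar>lim2 f - lim2 (poly_upto a d)\<bar> < e / 3"
    proof -
      have "lim2 f - lim2 (poly_upto a d) = (f (-1) - poly_upto a d (-1)) / 2 + (f 1 - poly_upto a d 1) / 2"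
        by (simp add: lim2_def field_simps)
      also have "\<bar>\<dots>\<bar> \<le> \<bar>f (-1) - poly_upto a d (-1)\<bar> / 2 + \<bar>f 1 - poly_upto a d 1\<bar> / 2"
        by (rule order_trans[OF abs_triangle_ineq]) simp
      also have "\<dots> < e / 3"
        using a[of "-1"] a[of 1] by simp
      finally show ?thesis .
    qed
    have 2: "\<bar>avg f n - avg (poly_upto a d) n\<bar> \<le> e / 3" for n
    proof -
      have "\<bar>\<Sum>k<n. f ((g1 ^^ (2 ^ k)) x) - poly_upto a d ((g1 ^^ (2 ^ k)) x)\<bar> \<le> (\<Sum>k<n. e / 3)"
        by (intro order_trans[OF sum_abs] sum_mono less_imp_le a g1_funpow_mem x)
      then have "\<bar>\<Sum>k<n. f ((g1 ^^ (2 ^ k)) x) - poly_upto a d ((g1 ^^ (2 ^ k)) x)\<bar> / real n \<le> e / 3"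
        using e by (cases "n = 0") (auto simp: field_simps)
      then show ?thesis
        by (simp add: avg_def sum_subtractf flip: diff_divide_distrib)
    qed
    obtain N where N: "\<And>n. n \<ge> N \<Longrightarrow> \<bar>avg (poly_upto a d) n - lim2 (poly_upto a d)\<bar> < e / 3"
      using LIMSEQ_D[OF poly[of a d], of "e / 3"] e by auto
    have "norm (avg f n - lim2 f) < e" if "n \<ge> N" for n
      unfolding real_norm_def using N[OF that] 1 2[of n] by linarith
    then show "\<exists>N. \<forall>n\<ge>N. norm (avg f n - lim2 f) < e"
      by blast
  qed
  then show "(\<lambda>n. \<integral>t. f t \<partial>mu_dyad n x) \<longlonglongrightarrow> (\<integral>t. f t \<partial>half_half)"
    unfolding integral_mu_dyad[OF f x] integral_half_half[OF f] avg_def lim2_def .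
qed

text \<open>There are countably many exponents, so one null set serves them all.\<close>

lemma AE_weak_star_tendsto: "AE x in leb_I. weak_star_tendsto (\<lambda>n. mu_dyad n x) half_half"
proof -
  have "AE x in leb_I. \<forall>m. (\<lambda>n. (\<Sum>k<n. ((g1 ^^ (2 ^ k)) x) ^ m) / real n) \<longlonglongrightarrow> ((-1) ^ m + 1) / 2"
    using AE_power_averages by (simp add: AE_all_countable)
  then show ?thesis
    by (rule AE_mp, intro AE_I2 impI) (simp add: weak_star_tendsto_if_powers)
qed

text \<open>\<open>leb_I\<close> inherits completeness from Lebesgue measure. This is what gives
  measurability of \<open>X_dyad\<close>, which is only shown to lie inside a null set.\<close>

lemma null_sets_leb_I_subset:
  assumes "A \<in> null_sets leb_I" "B \<subseteq> A"
  shows "B \<in> null_sets leb_I"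
proof -
  have null: "N \<in> null_sets leb_I \<longleftrightarrow> N \<in> null_sets (lebesgue_on {-1..1})" for N
    using AE_iff_null_sets[of N "lebesgue_on {-1..1}"] unfolding leb_I_eq by (auto simp: null_sets_density_iff)
  have "A \<in> null_sets lebesgue" "A \<subseteq> {-1..1}"
    using assms(1) by (auto simp: null null_sets_restrict_space)
  then have "B \<in> null_sets lebesgue" "B \<subseteq> {-1..1}"
    using assms(2) null_sets_completion_subset by blast+
  then show ?thesis
    by (simp add: null null_sets_restrict_space)
qed

theorem propositionB3:
  shows "(\<exists>D. D \<subseteq> mspace C_I \<and> countable D \<and> mtopology_of C_I closure_of D = mspace C_I \<and>
           (\<forall>\<phi>\<in>D. \<exists>C::real. \<forall>n\<ge>1.
              (\<Sum>i<n. \<Sum>j<n. \<bar>Cov leb_I (\<phi> \<circ> (g1 ^^ (2 ^ i))) (\<phi> \<circ> (g1 ^^ (2 ^ j)))\<bar>)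
                \<le> C * real n * ln (real n + 2)) \<and>
           (\<forall>\<phi>\<in>D. \<exists>C'::real. \<forall>n\<ge>1.
              (\<Sum>i<n. \<Sum>j<n. \<bar>Cov leb_I (\<phi> \<circ> (g1 ^^ (2 ^ i))) (\<phi> \<circ> (g1 ^^ (2 ^ j)))\<bar>)
                \<le> C' * real n powr (2 - 1 / 2))) \<and>
         (AE x in leb_I. weak_star_tendsto (\<lambda>n. mu_dyad n x) half_half) \<and>
         X_dyad \<in> null_sets leb_I"
proof (intro conjI exI[of _ "range rat_poly"] ballI)
  show "range rat_poly \<subseteq> mspace C_I"
    using rat_poly_mem_C_I by blast
  show "countable (range rat_poly)"
    by simp
  show "mtopology_of C_I closure_of range rat_poly = mspace C_I"
    by (rule closure_of_range_rat_poly)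
next
  fix \<phi> assume "\<phi> \<in> range rat_poly"
  then obtain cs where \<phi>: "\<phi> = rat_poly cs"
    by blast
  let ?S = "\<lambda>n. \<Sum>i<n. \<Sum>j<n. \<bar>Cov leb_I (\<phi> \<circ> (g1 ^^ (2 ^ i))) (\<phi> \<circ> (g1 ^^ (2 ^ j)))\<bar>"
  obtain C where C: "0 \<le> C" "\<And>n. ?S n \<le> C * real n"
    using Cov_dyadic_sum_le[of "\<lambda>i. of_rat (cs ! i)" "length cs"] unfolding \<phi> Cov_rat_poly by blast
  have "?S n \<le> C * real n * ln (real n + 2)" if "n \<ge> 1" for n
  proof -
    \<comment> \<open>Since \<open>exp 1 \<le> 3\<close>, the logarithm is at least 1 and the linear
      bound suffices.\<close>
    have "exp 1 \<le> real n + 2"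
      using exp_le that by linarith
    then have "1 \<le> ln (real n + 2)"
      by (subst ln_ge_iff) auto
    then have "C * real n * 1 \<le> C * real n * ln (real n + 2)"
      using C(1) by (intro mult_left_mono) auto
    then show ?thesis
      using C(2)[of n] by linarith
  qed
  then show "\<exists>C. \<forall>n\<ge>1. ?S n \<le> C * real n * ln (real n + 2)"
    by blast
next
  fix \<phi> assume "\<phi> \<in> range rat_poly"
  then obtain cs where \<phi>: "\<phi> = rat_poly cs"
    by blast
  let ?S = "\<lambda>n. \<Sum>i<n. \<Sum>j<n. \<bar>Cov leb_I (\<phi> \<circ> (g1 ^^ (2 ^ i))) (\<phi> \<circ> (g1 ^^ (2 ^ j)))\<bar>"
  obtain C where C: "0 \<le> C" "\<And>n. ?S n \<le> C * real n"
    using Cov_dyadic_sum_le[of "\<lambda>i. of_rat (cs ! i)" "length cs"] unfolding \<phi> Cov_rat_poly by blast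
  have "?S n \<le> C * real n powr (2 - 1 / 2)" if "n \<ge> 1" for n
  proof -
    have "real n powr 1 \<le> real n powr (2 - 1 / 2)"
      using that by (intro powr_mono) auto
    then have "C * real n \<le> C * real n powr (2 - 1 / 2)"
      using C(1) by (intro mult_left_mono) auto
    then show ?thesis
      using C(2)[of n] by linarith
  qed
  then show "\<exists>C'. \<forall>n\<ge>1. ?S n \<le> C' * real n powr (2 - 1 / 2)"
    by blast
next
  show "AE x in leb_I. weak_star_tendsto (\<lambda>n. mu_dyad n x) half_half"
    by (rule AE_weak_star_tendsto)
  then obtain A where A: "A \<in> null_sets leb_I" "{x \<in> space leb_I. \<not> weak_star_tendsto (\<lambda>n. mu_dyad n x) half_half} \<subseteq> A"
    by (auto simp: eventually_ae_filter)
  \<comment> \<open>\<open>half_half\<close> is itself an admissible limit, so convergence to it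
    keeps \<open>x\<close> out of \<open>X_dyad\<close>.\<close>
  have "X_dyad \<subseteq> A"
  proof
    fix x assume "x \<in> X_dyad"
    then have "x \<in> {-1..1}" "\<not> weak_star_tendsto (\<lambda>n. mu_dyad n x) half_half"
      using prob_space_half_half by (auto simp: X_dyad_def half_half_def)
    then show "x \<in> A"
      using A(2) by auto
  qed
  with A(1) show "X_dyad \<in> null_sets leb_I"
    by (rule null_sets_leb_I_subset)
qed

end
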